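(* For every matroid $N\in\mathcal E_3$, if $M$ is a simple binary matroid containing none of $I_3$, $F_7$, $N$ as an induced restriction, then $\chi(M)\le \dim(N)+4$.
   Context: A simple binary matroid (here just "matroid") is a pair $M=(E,G)$, where $G$ is identified with $\mathbb F_2^n\setminus\{0\}$ for some $n\ge 0$ and $E\subseteq G$; $\dim(M)=n$. A flat of $G$ is a set $V\setminus\{0\}$ with $V$ a subspace of $\mathbb F_2^n$; its dimension is $\dim V$. For a flat $F$, $M|F=(E\cap F,F)$ is an induced restriction of $M$. $M$ contains $N=(F',G')$ as an induced restriction if there is an injective linear map $\varphi:G'\to G$ (linear on the underlying vector spaces) with $\varphi(F')=E\cap\varphi(G')$. The critical number $\chi(M)$ is the smallest $k\ge0$ such that $G\setminus E$ contains a flat of dimension $n-k$. $\mathcal E_3$ is the class of matroids $M=(E,G)$ such that $|E\cap F|$ is even for every flat $F$ of $G$ of dimension at least $3$. $I_3$ is the $3$-dimensional matroid whose ground set is a set of $3$ linearly independent vectors; $F_7=(G,G)$ with $G=\mathbb F_2^3\setminus\{0\}$. *)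

theory Defs
  imports Complex_Main "HOL-Library.Z2" "HOL-Library.Function_Algebras"
begin

text \<open>Vectors over the two-element field are functions \<open>nat \<Rightarrow> bit\<close> with pointwise addition.
  The space \<open>F2 n\<close> consists of those supported on \<open>{0..<n}\<close>; this covers \<open>n = 0\<close> and lets the
  dimension be an ordinary natural number.\<close>

definition scale2 :: "bit \<Rightarrow> (nat \<Rightarrow> bit) \<Rightarrow> nat \<Rightarrow> bit" where
  "scale2 c v = (\<lambda>i. c * v i)"

global_interpretation bv: vector_space scale2
  by unfold_locales (auto simp: scale2_def fun_eq_iff algebra_simps)

definition F2 :: "nat \<Rightarrow> (nat \<Rightarrow> bit) set" where
  "F2 n = {v. \<forall>i\<ge>n. v i = 0}"

definition unit2 :: "nat \<Rightarrow> nat \<Rightarrow> bit" where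
  "unit2 i = (\<lambda>j. if j = i then 1 else 0)"

text \<open>\<open>Matroid n E\<close> is the pair \<open>(E, G)\<close> with \<open>G = F2 n - {0}\<close>; the condition \<open>E \<subseteq> G\<close> is the
  predicate \<open>simple_binary_matroid\<close>.\<close>

datatype matroid = Matroid (mdim: nat) (elts: "(nat \<Rightarrow> bit) set")

definition geometry :: "matroid \<Rightarrow> (nat \<Rightarrow> bit) set" where
  "geometry M = F2 (mdim M) - {0}"

definition simple_binary_matroid :: "matroid \<Rightarrow> bool" where
  "simple_binary_matroid M \<longleftrightarrow> elts M \<subseteq> geometry M"

definition is_flat :: "matroid \<Rightarrow> nat \<Rightarrow> (nat \<Rightarrow> bit) set \<Rightarrow> bool" where
  "is_flat M d F \<longleftrightarrow>
     (\<exists>V. bv.subspace V \<and> V \<subseteq> F2 (mdim M) \<and> bv.dim V = d \<and> F = V - {0})"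

text \<open>Linearity is required only on the domain \<open>F2 n\<close>; values elsewhere are irrelevant.\<close>

definition injective_linear :: "nat \<Rightarrow> nat \<Rightarrow> ((nat \<Rightarrow> bit) \<Rightarrow> nat \<Rightarrow> bit) \<Rightarrow> bool" where
  "injective_linear n m \<phi> \<longleftrightarrow>
     \<phi> ` F2 n \<subseteq> F2 m \<and> inj_on \<phi> (F2 n) \<and>
     (\<forall>x\<in>F2 n. \<forall>y\<in>F2 n. \<phi> (x + y) = \<phi> x + \<phi> y) \<and>
     (\<forall>c. \<forall>x\<in>F2 n. \<phi> (scale2 c x) = scale2 c (\<phi> x))"

definition contains_induced :: "matroid \<Rightarrow> matroid \<Rightarrow> bool" where
  "contains_induced M N \<longleftrightarrow>
     (\<exists>\<phi>. injective_linear (mdim N) (mdim M) \<phi> \<and> \<phi> ` elts N = elts M \<inter> \<phi> ` geometry N)"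

text \<open>The condition \<open>d + k = n\<close> expresses \<open>d = n - k\<close> without truncated subtraction. The value
  \<open>k = n\<close> always qualifies, by the empty flat, so the minimum exists.\<close>

definition critical_number :: "matroid \<Rightarrow> nat" where
  "critical_number M =
     (LEAST k. \<exists>d F. d + k = mdim M \<and> is_flat M d F \<and> F \<subseteq> geometry M - elts M)"

definition class_E3 :: "matroid set" where
  "class_E3 = {M. simple_binary_matroid M \<and>
     (\<forall>d F. 3 \<le> d \<and> is_flat M d F \<longrightarrow> even (card (elts M \<inter> F)))}"

definition I3 :: matroid where
  "I3 = Matroid 3 {unit2 0, unit2 1, unit2 2}"

definition F7 :: matroid where
  "F7 = Matroid 3 (F2 3 - {0})"

lemma subspace_F2: "bv.subspace (F2 n)"
  unfolding bv.subspace_def by (auto simp: F2_def scale2_def)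

lemma F2_Suc_decomp:
  assumes "v \<in> F2 (Suc n)"
  shows "v - scale2 (v n) (unit2 n) \<in> F2 n"
  using assms by (auto simp: F2_def scale2_def unit2_def Suc_le_eq)

lemma unit2_notin_F2: "unit2 n \<notin> F2 n"
  by (auto simp: F2_def unit2_def)

lemma F2_basis: "bv.independent (unit2 ` {..<n}) \<and> bv.span (unit2 ` {..<n}) = F2 n"
proof (induction n)
  case 0
  show ?case by (auto simp: F2_def fun_eq_iff bv.independent_empty)
next
  case (Suc n)
  have "bv.independent (unit2 ` {..<Suc n})"
    using Suc unit2_notin_F2[of n] by (simp add: lessThan_Suc bv.independent_insert)
  moreover have "bv.span (unit2 ` {..<Suc n}) = F2 (Suc n)"
  proof
    have "unit2 ` {..<Suc n} \<subseteq> F2 (Suc n)"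
      by (auto simp: F2_def unit2_def)
    then show "bv.span (unit2 ` {..<Suc n}) \<subseteq> F2 (Suc n)"
      by (simp add: bv.span_minimal subspace_F2)
    show "F2 (Suc n) \<subseteq> bv.span (unit2 ` {..<Suc n})"
      using Suc F2_Suc_decomp[of _ n] by (auto simp: lessThan_Suc bv.span_insert)
  qed
  ultimately show ?case by blast
qed

lemma dim_F2: "bv.dim (F2 n) = n"
proof -
  have "inj_on unit2 {..<n}"
    by (rule inj_onI) (metis unit2_def zero_neq_one)
  then have "card (unit2 ` {..<n}) = n"
    by (simp add: card_image)
  moreover have "bv.dim (F2 n) = card (unit2 ` {..<n})"
    using F2_basis[of n] by (metis bv.dim_eq_card bv.span_span)
  ultimately show ?thesis by simp
qed

lemma finite_F2: "finite (F2 n)"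
proof (induction n)
  case 0
  have "F2 0 = {0}" by (auto simp: F2_def fun_eq_iff)
  then show ?case by simp
next
  case (Suc n)
  have "v \<in> (\<lambda>(c, w). w + scale2 c (unit2 n)) ` ((UNIV :: bit set) \<times> F2 n)"
    if "v \<in> F2 (Suc n)" for v
    using F2_Suc_decomp[OF that] by (force intro: image_eqI[where x = "(v n, v - scale2 (v n) (unit2 n))"])
  moreover have "finite (UNIV :: bit set)"
  proof -
    have "(UNIV :: bit set) = {0, 1}" using bit_not_zero_iff by blast
    then show ?thesis by (metis finite.simps)
  qed
  ultimately show ?case
    using Suc by (meson finite_SigmaI finite_imageI finite_subset subsetI)
qed

lemma critical_number_le_mdim: "critical_number M \<le> mdim M"
proof -
  have "bv.dim {0} = card ({} :: (nat \<Rightarrow> bit) set)"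
    by (rule bv.dim_eq_card) (auto simp: bv.independent_empty bv.span_insert_0)
  then have "is_flat M 0 {}"
    unfolding is_flat_def
    by (intro exI[of _ "{0}"]) (auto simp: bv.subspace_single_0 F2_def)
  then show ?thesis
    unfolding critical_number_def by (intro Least_le) force
qed

end

theory Submission
  imports Defs
begin

text \<open>Let \<open>V\<close> be the span of \<open>E\<close>, and let \<open>Z\<close> be a maximal subspace avoiding \<open>E\<close>; then every
  coset of \<open>Z\<close> other than \<open>Z\<close> itself meets \<open>E\<close>, and it suffices to cover \<open>E\<close> by the span of \<open>Z\<close>
  and few further vectors.

  Suppose some plane meets \<open>E\<close> in all points except \<open>c\<close> and \<open>d\<close>, and let \<open>u\<close> be a point of this plane
  off the line \<open>C\<close> through \<open>c\<close> and \<open>d\<close>. The vectors \<open>x\<close> with \<open>x + C \<subseteq> E\<close> are closed under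
  \<open>(x, y) \<mapsto> x + y + u\<close>, and translating them by \<open>u\<close> gives a hyperplane \<open>U\<close> of \<open>V\<close> with
  \<open>V - U \<subseteq> E\<close>. As there is no Fano plane, \<open>E \<inter> U\<close> has no triangle, so the absence of claws makes it
  an affine space, and the critical number is at most 2.

  If no such plane exists, then every plane of \<open>V\<close> meets \<open>E\<close> in an even number of points, that is,
  the indicator of \<open>E\<close> is a quadratic form on \<open>V\<close>. The subspace \<open>Z \<inter> V\<close> is totally singular and
  the form is anisotropic on its orthogonal space modulo \<open>Z \<inter> V\<close>, so by the absence of a Fano plane this
  quotient has dimension at most 2. Hence, if the codimension of \<open>Z\<close> is at least \<open>dim N + 2\<close>,
  there are enough vectors of \<open>V\<close> dual to vectors of \<open>Z\<close> to embed the quadratic form of \<open>N\<close>: take any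
  dual vectors and correct their values and pairings by adding elements of \<open>Z\<close>.\<close>

section \<open>Vectors and subspaces in characteristic 2\<close>

lemma add_self [simp]: "x + x = (0 :: nat \<Rightarrow> bit)"
  by (simp add: fun_eq_iff)

lemma add_self_left [simp]: "x + (x + y) = (y :: nat \<Rightarrow> bit)"
  by (simp add: add.assoc[symmetric])

lemma add_eq_zero_iff_eq: "x + y = 0 \<longleftrightarrow> x = (y :: nat \<Rightarrow> bit)"
  by (metis add.right_neutral add_self_left add_self)

text \<open>Needed because arithmetic simplification procedures turn \<open>x + x\<close> into \<open>2 * x\<close>.\<close>

lemma two_mult [simp]: "2 * x = (0 :: nat \<Rightarrow> bit)"
  by (simp only: mult_2 add_self)

lemma add_self_bit: "x + x = (0 :: bit)" by simp

lemma add_self_left_bit: "x + (x + y) = (y :: bit)"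
  by (simp only: add.assoc[symmetric] add_self_bit add_0_left)

text \<open>Rewriting with these rules alone sorts sums and cancels equal summands, for vectors and
  for bits.\<close>

lemmas char2 = add_self add_self_left add_self_bit add_self_left_bit
  add_0_left add_0_right add.assoc add.commute add.left_commute

lemma scale2_simps [simp]: "scale2 0 x = 0" "scale2 1 x = x"
  by (auto simp: scale2_def)

lemma bit_cases: "c = 0 \<or> c = (1::bit)"
  using bit_not_zero_iff by blast

lemma subspace_iff: "bv.subspace S \<longleftrightarrow> 0 \<in> S \<and> (\<forall>x\<in>S. \<forall>y\<in>S. x + y \<in> S)"
proof -
  have "scale2 c x \<in> S" if "0 \<in> S" "x \<in> S" for c x
    using bit_cases[of c] that by auto
  then show ?thesis unfolding bv.subspace_def by blast
qed

lemma subspace_insert: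
  assumes "bv.subspace Z"
  shows "bv.subspace (Z \<union> (+) v ` Z)"
proof -
  have Z: "0 \<in> Z" "\<And>x y. x \<in> Z \<Longrightarrow> y \<in> Z \<Longrightarrow> x + y \<in> Z"
    using assms by (auto simp: subspace_iff)
  have *: "x + (v + y) = v + (x + y)" "(v + x) + (v + y) = x + y" for x y :: "nat \<Rightarrow> bit"
    by (simp_all add: add_ac)
  show ?thesis unfolding subspace_iff
    using Z by (auto simp: * add.assoc)
qed

section \<open>Sets without induced claws and Fano planes\<close>

text \<open>A claw is an induced copy of \<open>I3\<close>. Since \<open>0 \<notin> E\<close>, the
  inequations in \<open>claw_free\<close> express independence, and a dependent triple satisfies
  \<open>fano_free\<close> trivially because one of the sums is then 0.\<close>

locale claw_fano_free =
  fixes E :: "(nat \<Rightarrow> bit) set"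
  assumes zero_notin: "0 \<notin> E"
    and claw_free: "\<lbrakk>a \<in> E; b \<in> E; c \<in> E; a \<noteq> b; a \<noteq> c; b \<noteq> c; a + b \<noteq> c;
          a + b \<notin> E; a + c \<notin> E; b + c \<notin> E\<rbrakk> \<Longrightarrow> a + b + c \<in> E"
    and fano_free: "\<lbrakk>a \<in> E; b \<in> E; c \<in> E; a + b \<in> E; a + c \<in> E; b + c \<in> E\<rbrakk> \<Longrightarrow> a + b + c \<notin> E"
begin

definition ind :: "(nat \<Rightarrow> bit) \<Rightarrow> bit" where "ind x = of_bool (x \<in> E)"

lemma ind_simps [simp]: "ind 0 = 0" "x \<in> E \<Longrightarrow> ind x = 1" "x \<notin> E \<Longrightarrow> ind x = 0"
  using zero_notin by (auto simp: ind_def)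

text \<open>The plane spanned by \<open>c\<close>, \<open>d\<close>, \<open>u\<close> has only \<open>c\<close> and \<open>d\<close> outside \<open>E\<close>. Independence of
  the three vectors is automatic because \<open>0 \<notin> E\<close>.\<close>

definition five_point_plane :: "(nat \<Rightarrow> bit) \<Rightarrow> (nat \<Rightarrow> bit) \<Rightarrow> (nat \<Rightarrow> bit) \<Rightarrow> bool" where
  "five_point_plane c d u \<longleftrightarrow> c \<notin> E \<and> d \<notin> E \<and> c + d \<in> E \<and> u \<in> E \<and> u + c \<in> E \<and> u + d \<in> E \<and> u + c + d \<in> E"

section \<open>Parity of planes in the absence of five-point planes\<close>

text \<open>The set \<open>S\<close> of all \<open>x\<close> such that exactly one of
  \<open>x\<close>, \<open>x + p\<close> lies in \<open>E\<close> is a subspace and has index at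
  most 2 relative to the span of \<open>E\<close>. The seven terms are \<open>ind p\<close> and
  three values of \<open>\<sigma>\<close>, which is 1 plus a linear functional on the span.\<close>

lemma even_planes_through:
  assumes nofive: "\<And>c d u. \<not> five_point_plane c d u" and p: "p \<in> E"
    and x: "x \<in> bv.span E" and y: "y \<in> bv.span E"
  shows "ind p + ind x + ind y + ind (x + y) + ind (p + x) + ind (p + y) + ind (p + x + y) = 0"
proof -
  define \<sigma> where "\<sigma> x = ind x + ind (x + p)" for x
  define S where "S = {x. \<sigma> x = 1}"
  have \<sigma>p: "\<sigma> (x + p) = \<sigma> x" for x
    by (simp only: \<sigma>_def char2)
  have S0: "0 \<in> S" using p by (simp add: S_def \<sigma>_def)
  have Sp: "x + p \<in> S \<longleftrightarrow> x \<in> S" for x by (simp add: S_def \<sigma>p)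
  have S_one: "x \<in> S \<longleftrightarrow> (x \<in> E) \<noteq> (x + p \<in> E)" for x
    by (auto simp: S_def \<sigma>_def ind_def)
  \<comment> \<open>If \<open>a + b\<close> were outside \<open>S\<close>, then \<open>a\<close>,
    \<open>b\<close>, \<open>p\<close> would form a claw, or their plane would miss \<open>E\<close>
    in \<open>a + p\<close> and \<open>b + p\<close> only.\<close>
  have closed0: "a + b \<in> S" if "a \<in> E" "a + p \<notin> E" "b \<in> E" "b + p \<notin> E" for a b
  proof (cases "a = b \<or> a = p \<or> b = p \<or> a + b = p")
    case True
    have "p \<in> S" "a + p \<in> S" "p + b \<in> S"
      using S0 Sp[of 0] Sp[of a] Sp[of b] that S_one by (auto simp: add.commute)
    then show ?thesis using True S0 by auto
  next
    case False
    show ?thesis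
    proof (rule ccontr)
      assume "a + b \<notin> S"
      then consider "a + b \<in> E" "a + b + p \<in> E" | "a + b \<notin> E" "a + b + p \<notin> E"
        using S_one by blast
      then show False
      proof cases
        case 1
        then have "five_point_plane (a + p) (b + p) p"
          using that p unfolding five_point_plane_def by (simp add: add_ac)
        then show False using nofive by blast
      next
        case 2
        then show False using claw_free[of a b p] that p False by blast
      qed
    qed
  qed
  have closed: "a + b \<in> S" if ab: "a \<in> S" "b \<in> S" for a b
  proof -
    obtain a' where a': "a' = a \<or> a' = a + p" "a' \<in> E" "a' + p \<notin> E"
      using ab S_one[of a] by (cases "a \<in> E") (force simp: add.assoc)+
    obtain b' where b': "b' = b \<or> b' = b + p" "b' \<in> E" "b' + p \<notin> E"
      using ab S_one[of b] by (cases "b \<in> E") (force simp: add.assoc)+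
    have "a + b = a' + b' \<or> a + b + p = a' + b'"
      using a'(1) b'(1) by (auto simp: add_ac)
    then show ?thesis using closed0[OF a'(2,3) b'(2,3)] Sp[of "a + b"] by auto
  qed
  have sub: "bv.subspace S" using S0 closed by (auto simp: subspace_iff)
  \<comment> \<open>Otherwise the plane of \<open>a\<close>, \<open>b\<close>, \<open>p\<close> is a
    Fano plane or misses \<open>E\<close> in \<open>a + b\<close> and \<open>a + b + p\<close>
    only.\<close>
  have D: "a + b \<in> S" if "a \<in> E" "a + p \<in> E" "b \<in> E" "b + p \<in> E" for a b
  proof (rule ccontr)
    assume n: "a + b \<notin> S"
    then consider "a + b \<in> E" "a + b + p \<in> E" | "a + b \<notin> E" "a + b + p \<notin> E"
      using S_one by blast
    then show False
    proof cases
      case 1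
      then show False using fano_free[of a b p] that p by blast
    next
      case 2
      then have "five_point_plane (a + b) (a + b + p) a"
        using that p unfolding five_point_plane_def by (simp add: add_ac)
      then show False using nofive by blast
    qed
  qed
  txt \<open>Two elements of \<open>E - S\<close> differ by an element of \<open>S\<close>, hence \<open>S\<close> has index at most 2 in the
    span of \<open>E\<close>, and so \<open>\<sigma> x + \<sigma> y + \<sigma> (x + y)\<close> is always 1.\<close>
  have "\<exists>\<delta>. E \<subseteq> S \<union> (+) \<delta> ` S"
  proof (cases "\<exists>\<delta>. \<delta> \<in> E \<and> \<delta> + p \<in> E")
    case True
    then obtain \<delta> where d: "\<delta> \<in> E" "\<delta> + p \<in> E" by blast
    have "e \<in> S \<union> (+) \<delta> ` S" if "e \<in> E" for e
    proof (cases "e + p \<in> E")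
      case True
      then have "\<delta> + e \<in> S" using D d that by blast
      then have "\<delta> + (\<delta> + e) \<in> (+) \<delta> ` S" by blast
      then show ?thesis by simp
    qed (use S_one that in blast)
    then show ?thesis by blast
  next
    case False
    then have "E \<subseteq> S" using S_one by blast
    then show ?thesis by blast
  qed
  then obtain \<delta> where "E \<subseteq> S \<union> (+) \<delta> ` S" by blast
  then have sp: "bv.span E \<subseteq> S \<union> (+) \<delta> ` S"
    by (intro bv.span_minimal subspace_insert sub)
  have key: "a + b \<in> S" if ab: "a \<in> bv.span E" "b \<in> bv.span E" "a \<notin> S" "b \<notin> S" for a b
  proof -
    obtain s t where "s \<in> S" "t \<in> S" "a = \<delta> + s" "b = \<delta> + t" using sp ab by blast
    then show ?thesis using closed[of s t] by (simp add: add_ac)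
  qed
  have key': "a + b \<notin> S" if "a \<in> S" "b \<notin> S" for a b
    using closed[of a "a + b"] that by auto
  have ns: "a \<in> S \<Longrightarrow> \<sigma> a = 1" "a \<notin> S \<Longrightarrow> \<sigma> a = 0" for a
    using bit_cases[of "\<sigma> a"] by (auto simp: S_def)
  have "x + y \<in> S \<longleftrightarrow> (x \<in> S \<longleftrightarrow> y \<in> S)"
    using key[OF x y] key'[of x y] key'[of y x] closed[of x y]
    unfolding add.commute[of y x] by blast
  then have "\<sigma> x + \<sigma> y + \<sigma> (x + y) = ind p"
    using p by (cases "x \<in> S"; cases "y \<in> S") (simp_all add: ns)
  then have "ind p + (\<sigma> x + \<sigma> y + \<sigma> (x + y)) = 0" by (simp only: char2)
  then show ?thesis by (simp only: \<sigma>_def char2)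
qed

text \<open>Any of the seven points that lies in \<open>E\<close> can serve as \<open>p\<close> in
  \<open>even_planes_through\<close>; if there is none, all terms vanish.\<close>

lemma even_planes:
  assumes nofive: "\<And>c d u. \<not> five_point_plane c d u"
    and x: "x \<in> bv.span E" and y: "y \<in> bv.span E" and z: "z \<in> bv.span E"
  shows "ind x + ind y + ind z + ind (x + y) + ind (x + z) + ind (y + z) + ind (x + y + z) = 0"
proof -
  note T = even_planes_through[OF nofive]
  have s: "x + y \<in> bv.span E" using x y bv.span_add by blast
  consider "x \<in> E" | "y \<in> E" | "z \<in> E" | "x + y \<in> E" | "x + z \<in> E" | "y + z \<in> E"
    | "x + y + z \<in> E" | "{x, y, z, x + y, x + z, y + z, x + y + z} \<inter> E = {}" by blast
  then show ?thesis
  proof cases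
    case 1 then show ?thesis using T[OF 1 y z] by (simp only: char2)
  next
    case 2 then show ?thesis using T[OF 2 x z] by (simp only: char2)
  next
    case 3 then show ?thesis using T[OF 3 x y] by (simp only: char2)
  next
    case 4 then show ?thesis using T[OF 4 x z] by (simp only: char2)
  next
    case 5 then show ?thesis using T[OF 5 x y] by (simp only: char2)
  next
    case 6 then show ?thesis using T[OF 6 x y] by (simp only: char2)
  next
    case 7 then show ?thesis using T[OF 7 x y] by (simp only: char2)
  next
    case 8 then show ?thesis by simp
  qed
qed

section \<open>Structure forced by a five-point plane\<close>

definition pair_span :: "(nat \<Rightarrow> bit) \<Rightarrow> (nat \<Rightarrow> bit) \<Rightarrow> (nat \<Rightarrow> bit) set" where
  "pair_span c d = {0, c, d, c + d}"

text \<open>The claw and Fano conditions become propositional constraints on which of the eight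
  vectors \<open>e + y\<close>, for \<open>y\<close> in the span \<open>P\<close> of
  \<open>c\<close>, \<open>d\<close>, \<open>u\<close>, lie in \<open>E\<close>. Together with
  \<open>e \<in> E\<close> and \<open>e + c \<notin> E\<close> they force the conclusion.\<close>

lemma five_local_step:
  assumes five: "five_point_plane c d u" and e: "e \<in> E" "e + c \<notin> E"
    and eP: "e \<notin> pair_span c d \<union> (+) u ` pair_span c d"
  shows "(+) (e + u) ` pair_span c d \<subseteq> E"
proof -
  have F: "c \<notin> E" "d \<notin> E" "c + d \<in> E" "u \<in> E" "c + u \<in> E" "d + u \<in> E" "c + (d + u) \<in> E"
    using five by (simp_all add: five_point_plane_def add_ac)
  have nz: "c \<noteq> 0" "d \<noteq> 0" "c \<noteq> d" "u \<noteq> 0" "u \<noteq> c" "u \<noteq> d" "u \<noteq> c + d"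
    using F zero_notin by (auto simp: add_ac)
  define P where "P = pair_span c d \<union> (+) u ` pair_span c d"
  have Pp: "a + b \<in> P" if "a \<in> P" "b \<in> P" for a b
    using that unfolding P_def pair_span_def by (auto simp: add_ac)
  have Pin: "0 \<in> P" "c \<in> P" "d \<in> P" "c + d \<in> P" "u \<in> P" "c + u \<in> P" "d + u \<in> P" "c + (d + u) \<in> P"
    by (auto simp: P_def pair_span_def add_ac)
  have yP: "e + y \<notin> P" if "y \<in> P" for y
    using Pp[of "e + y" y] that eP by (auto simp: add_ac P_def)
  have clm: "a + b \<in> E \<or> a + b' \<in> E \<or> a + b + b' \<in> E"
    if "a \<in> E" "b \<in> E" "b' \<in> E" "a \<notin> P" "b \<in> P" "b' \<in> P" "b \<noteq> b'" "b + b' \<notin> E" for a b b'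
  proof -
    have "a \<noteq> b" "a \<noteq> b'" using that by auto
    moreover have "a + b \<noteq> b'"
      using that Pp[of b b'] by (metis add.commute add_self_left)
    then show ?thesis using claw_free[of a b b'] that by blast
  qed
  define g where "g y \<longleftrightarrow> e + y \<in> E" for y
  \<comment> \<open>Both \<open>t\<close> and \<open>t + c\<close> lie in \<open>E\<close> but their
    sum \<open>c\<close> does not, so with \<open>e + y\<close> they are candidates for a
    claw.\<close>
  have h1: "g y \<longrightarrow> g (y + c) \<or> g (y + t) \<or> g (y + t + c)" if "y \<in> P" "t \<in> {u, d + u}" for y t
    using clm[of "e + y" t "t + c"] yP[of y] that Pin F nz
    by (auto simp: g_def char2)
  \<comment> \<open>The candidates are \<open>e + y\<close>, \<open>e + y + d\<close> and
    \<open>c + d\<close>; the sum \<open>d\<close> of the first two and the total sum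
    \<open>c\<close> are outside \<open>E\<close>.\<close>
  have h2: "g y \<and> g (y + d) \<longrightarrow> g (y + c + d) \<or> g (y + c)"
    if "y \<in> P" for y
  proof
    assume g: "g y \<and> g (y + d)"
    have "e + y \<noteq> c" "e + y \<noteq> c + d" using yP[OF that] Pin by auto
    then show "g (y + c + d) \<or> g (y + c)"
      using claw_free[of "e + y" "e + y + d" "c + d"] g F nz
      by (auto simp: g_def char2)
  qed
  have h3: "\<not> (g y \<and> g (y + c + d) \<and> g (y + t) \<and> g (y + t + c + d))"
    if "t \<in> {u, c + u}" for y t
    using fano_free[of "e + y" "c + d" t] that F by (auto simp: g_def char2)
  have "g u \<and> g (c + u) \<and> g (d + u) \<and> g (c + (d + u))"
  proof -
    have "g 0" "\<not> g c" using e by (simp_all add: g_def)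
    moreover have "g y \<longrightarrow> g (c + y) \<or> g (u + y) \<or> g (c + (u + y))"
      "g y \<longrightarrow> g (c + y) \<or> g (d + (u + y)) \<or> g (c + (d + (u + y)))"
      if "y \<in> {0, u, c + u, d + u, c + (d + u)}" for y
      using h1[of y u] h1[of y "d + u"] that Pin by (auto simp: char2)
    note this[of 0] this[of u] this[of "c + u"] this[of "d + u"] this[of "c + (d + u)"]
    moreover note h2[OF Pin(1)] h2[OF Pin(5)] h2[OF Pin(6)]
       h3[of u 0] h3[of "c + u" 0] h3[of u c] h3[of "c + u" c]
    ultimately show ?thesis
      by (simp (no_asm_use) only: char2 insert_iff simp_thms) argo
  qed
  then show ?thesis by (auto simp: g_def pair_span_def char2)
qed


definition full_cosets :: "(nat \<Rightarrow> bit) \<Rightarrow> (nat \<Rightarrow> bit) \<Rightarrow> (nat \<Rightarrow> bit) set" where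
  "full_cosets c d = {x. (+) x ` pair_span c d \<subseteq> E}"

lemma full_cosets_iff:
  "x \<in> full_cosets c d \<longleftrightarrow> x \<in> E \<and> x + c \<in> E \<and> x + d \<in> E \<and> x + (c + d) \<in> E"
  by (auto simp: full_cosets_def pair_span_def)

lemma full_cosets_add:
  "t \<in> pair_span c d \<Longrightarrow> x + t \<in> full_cosets c d \<longleftrightarrow> x \<in> full_cosets c d"
  by (auto simp: full_cosets_iff pair_span_def char2)

text \<open>If \<open>e\<close> is outside the plane and \<open>e + u\<close> is not in
  \<open>full_cosets c d\<close>, then \<open>five_local_step\<close> gives
  \<open>e + c \<in> E\<close>, and \<open>e + d \<in> E\<close> by exchanging \<open>c\<close> and
  \<open>d\<close>. A third application, at \<open>e + c\<close>, gives
  \<open>e + c + d \<in> E\<close>.\<close>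

lemma five_local:
  assumes five: "five_point_plane c d u" and e: "e \<in> E"
  shows "e \<in> full_cosets c d \<or> e + u \<in> full_cosets c d"
proof (cases "e \<in> pair_span c d \<union> (+) u ` pair_span c d")
  case True
  have u: "u \<in> full_cosets c d" using five by (simp add: five_point_plane_def full_cosets_iff add.assoc)
  show ?thesis
  proof (cases "e \<in> pair_span c d")
    case True
    then have "e = c + d" using e five zero_notin unfolding pair_span_def five_point_plane_def by blast
    then have "e \<in> pair_span c d" by (simp add: pair_span_def)
    from full_cosets_add[OF this, of u] u show ?thesis by (simp add: add.commute)
  next
    case False
    then obtain t where "t \<in> pair_span c d" "e = u + t" using True by blast
    then show ?thesis using full_cosets_add u by blast
  qed
next
  case False
  have P: "pair_span d c = pair_span c d" by (auto simp: pair_span_def add.commute)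
  have five': "five_point_plane d c u" using five by (simp add: five_point_plane_def add_ac)
  show ?thesis
  proof (rule ccontr)
    assume n: "\<not> ?thesis"
    have "e + c \<in> E" using five_local_step[OF five e _ False] n by (auto simp: full_cosets_def)
    moreover have "e + d \<in> E"
      using five_local_step[OF five' e] False n by (auto simp: full_cosets_def P)
    moreover have "e + c + d \<in> E"
    proof (rule ccontr)
      assume "e + c + d \<notin> E"
      moreover have "e + c \<notin> pair_span c d \<union> (+) u ` pair_span c d"
      proof
        assume "e + c \<in> pair_span c d \<union> (+) u ` pair_span c d"
        then obtain s where s: "s \<in> pair_span c d" "e + c = s \<or> e + c = u + s" by blast
        have "s + c \<in> pair_span c d" using s(1) by (auto simp: pair_span_def char2)
        moreover have "e = s + c \<or> e = u + (s + c)"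
          using s(2) by (metis add.assoc add_self add_0_right)
        ultimately show False using False by blast
      qed
      ultimately have "e + c + u \<in> full_cosets c d"
        using five_local_step[OF five' \<open>e + c \<in> E\<close>] by (auto simp: full_cosets_def P)
      then show False using n full_cosets_add[of c c d "e + u"] by (simp add: pair_span_def add_ac)
    qed
    ultimately show False using n e by (auto simp: full_cosets_iff add.assoc)
  qed
qed

text \<open>Two points of \<open>E\<close> in the coset would differ by \<open>c\<close> or
  \<open>d\<close>, since a difference of \<open>c + d\<close> is excluded; with
  \<open>c + d\<close> they would form a claw.\<close>

lemma coset_unique:
  assumes five: "five_point_plane c d u"
    and nopair: "\<And>t. t \<in> pair_span c d \<Longrightarrow> x + t \<in> E \<Longrightarrow> x + t + (c + d) \<notin> E"
    and st: "s \<in> pair_span c d" "t \<in> pair_span c d" "x + s \<in> E" "x + t \<in> E"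
  shows "s = t"
proof (rule ccontr)
  assume "s \<noteq> t"
  have F: "c \<notin> E" "d \<notin> E" "c + d \<in> E" using five by (simp_all add: five_point_plane_def)
  define p v where "p = x + s" and "v = s + t"
  have p: "p \<in> E" "p + v \<in> E" "x + t = p + v"
    using st by (simp_all add: p_def v_def char2)
  have w: "p + (c + d) \<notin> E" "p + v + (c + d) \<notin> E"
    using nopair[OF st(1,3)] nopair[OF st(2,4)] p(3) by (simp_all add: p_def)
  have "v \<noteq> 0" using \<open>s \<noteq> t\<close> by (simp add: v_def add_eq_zero_iff_eq)
  moreover have "v \<noteq> c + d" using w(1) p(2) by auto
  moreover have "v \<in> pair_span c d" using st(1,2) by (auto simp: v_def pair_span_def char2)
  ultimately have cd: "v = c \<or> v = d" by (auto simp: pair_span_def)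
  then have v: "v \<notin> E" "v + (c + d) \<notin> E" using F by (auto simp: char2)
  have "p \<noteq> c + d" using p(2) v(2) by (metis add.commute)
  moreover have "p + v \<noteq> c + d" using p(1) v(2) by (metis add.commute add_self_left)
  ultimately have "p \<noteq> c + d" "p + v \<noteq> c + d" by blast+
  then show False
    using claw_free[of p "p + v" "c + d"] p(1,2) w F(3) v \<open>v \<noteq> 0\<close> \<open>v \<noteq> c + d\<close> by simp
qed

text \<open>Otherwise \<open>x\<close>, \<open>y + t\<close> and \<open>c + d\<close> would span a
  Fano plane. By \<open>coset_unique\<close>, the coset of \<open>x + y\<close> then has at most one
  point in \<open>E\<close>.\<close>

lemma full_cosets_triangle_free:
  assumes five: "five_point_plane c d u" and xy: "x \<in> full_cosets c d" "y \<in> full_cosets c d"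
    and t: "t \<in> pair_span c d" "x + y + t \<in> E"
  shows "x + y + t + (c + d) \<notin> E"
proof -
  have "c + d \<in> E" using five by (simp add: five_point_plane_def)
  moreover have "y + t \<in> full_cosets c d" using full_cosets_add t(1) xy(2) by blast
  ultimately show ?thesis
    using fano_free[of x "y + t" "c + d"] xy(1) t(2) by (auto simp: full_cosets_iff add_ac)
qed

text \<open>If this fails, the coset of \<open>x + y + u\<close> misses \<open>E\<close>, whereas
  those of \<open>x + u\<close>, \<open>y + u\<close> and \<open>x + y\<close> have at most one
  point in \<open>E\<close> each. Moving \<open>x\<close> and \<open>y\<close> within their cosets
  avoids these points and gives a claw with \<open>u\<close>.\<close>

lemma full_cosets_affine:
  assumes five: "five_point_plane c d u" and x: "x \<in> full_cosets c d" and y: "y \<in> full_cosets c d"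
  shows "x + y + u \<in> full_cosets c d"
proof (rule ccontr)
  assume n: "x + y + u \<notin> full_cosets c d"
  have u: "u \<in> full_cosets c d" using five by (simp add: five_point_plane_def full_cosets_iff add.assoc)
  have uniq: "s = t" if "a \<in> full_cosets c d" "b \<in> full_cosets c d"
      "s \<in> pair_span c d" "t \<in> pair_span c d" "a + b + s \<in> E" "a + b + t \<in> E" for a b s t
    using coset_unique[OF five _ that(3-6)] full_cosets_triangle_free[OF five that(1,2)] by blast
  have P: "0 \<in> pair_span c d" "c \<in> pair_span c d" "d \<in> pair_span c d" by (auto simp: pair_span_def)
  have nz: "c \<noteq> 0" "d \<noteq> 0" "c \<noteq> d" using five zero_notin by (auto simp: five_point_plane_def)
  have empty: "x + y + u + t \<notin> E" if t: "t \<in> pair_span c d" for t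
  proof
    assume "x + y + u + t \<in> E"
    then have "x + y + u + t + u \<in> full_cosets c d"
      using five_local[OF five] n full_cosets_add[OF t] by blast
    then have "x + y + t \<in> full_cosets c d" by (simp add: char2)
    then show False
      using full_cosets_triangle_free[OF five x y t] by (simp add: full_cosets_iff)
  qed
  obtain s where s: "s \<in> pair_span c d" "x + u + s \<notin> E"
    using uniq[OF x u P(1) P(2)] P nz by metis
  define x' where "x' = x + s"
  have x': "x' \<in> full_cosets c d" using full_cosets_add s(1) x by (simp add: x'_def)
  \<comment> \<open>Each of the two conditions rules out at most one of the three
    candidates.\<close>
  have "\<exists>t \<in> {0, c, d}. y + u + t \<notin> E \<and> x' + y + t \<notin> E"
    using uniq[OF y u P(1) P(2)] uniq[OF y u P(1) P(3)] uniq[OF y u P(2) P(3)]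
      uniq[OF x' y P(1) P(2)] uniq[OF x' y P(1) P(3)] uniq[OF x' y P(2) P(3)] nz
    by blast
  then obtain t where t: "t \<in> pair_span c d" "y + u + t \<notin> E" "x' + y + t \<notin> E"
    using P by blast
  define y' where "y' = y + t"
  have y': "y' \<in> full_cosets c d" using full_cosets_add t(1) y by (simp add: y'_def)
  have E: "x' \<in> E" "y' \<in> E" "u \<in> E" using x' y' u by (auto simp: full_cosets_iff)
  have "s + t \<in> pair_span c d" using s(1) t(1) by (auto simp: pair_span_def char2)
  from empty[OF this] have e: "x' + y' + u \<notin> E" by (simp add: x'_def y'_def add_ac)
  have "x' + y' \<notin> E" "x' + u \<notin> E" "y' + u \<notin> E"
    using s t by (simp_all add: x'_def y'_def add_ac)
  moreover from e E this have "x' \<noteq> y'" "x' \<noteq> u" "y' \<noteq> u" "x' + y' \<noteq> u"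
    using add_self[of y'] by (auto simp: add.assoc)
  ultimately show False using claw_free[of x' y' u] E e by blast
qed

lemma five_structure:
  assumes five: "five_point_plane c d u"
  obtains U where "bv.subspace U" "u \<in> E"
    "\<And>x. x \<in> bv.span E \<Longrightarrow> x \<in> U \<or> x + u \<in> U" "\<And>x. x + u \<in> U \<Longrightarrow> x \<in> E"
proof -
  define U where "U = (+) u ` full_cosets c d"
  have U: "x \<in> U \<longleftrightarrow> x + u \<in> full_cosets c d" for x
  proof
    assume "x + u \<in> full_cosets c d"
    then have "u + (x + u) \<in> U" unfolding U_def by (rule imageI)
    moreover have "u + (x + u) = x" by (simp add: char2)
    ultimately show "x \<in> U" by metis
  next
    assume "x \<in> U"
    then obtain y where "y \<in> full_cosets c d" "x = u + y" by (auto simp: U_def)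
    then show "x + u \<in> full_cosets c d" by (simp add: char2)
  qed
  have u: "u \<in> full_cosets c d" using five by (simp add: five_point_plane_def full_cosets_iff add.assoc)
  have sub: "bv.subspace U"
    unfolding subspace_iff
  proof (intro conjI ballI)
    fix x y assume "x \<in> U" "y \<in> U"
    then have "(x + u) + (y + u) + u \<in> full_cosets c d"
      using full_cosets_affine[OF five] U by blast
    then show "x + y \<in> U" by (simp add: U char2)
  qed (simp add: U u)
  have "E \<subseteq> U \<union> (+) u ` U"
  proof
    fix e assume "e \<in> E"
    then have "e \<in> U \<or> e + u \<in> U" using five_local[OF five] U by (auto simp: add.assoc)
    moreover have "e = u + (e + u)" by (simp add: char2)
    ultimately show "e \<in> U \<union> (+) u ` U" by blast
  qed
  then have "bv.span E \<subseteq> U \<union> (+) u ` U"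
    by (intro bv.span_minimal subspace_insert sub)
  then have "x \<in> U \<or> x + u \<in> U" if "x \<in> bv.span E" for x
    using that by (auto simp: char2)
  moreover have "x \<in> E" if "x + u \<in> U" for x
    using that by (simp add: U add.assoc full_cosets_iff)
  ultimately show ?thesis
    using that sub five by (auto simp: five_point_plane_def)
qed

end

section \<open>Maximal subspaces avoiding the set, and the critical number\<close>

text \<open>A basis of \<open>Z\<close> together with \<open>S\<close> spans the whole space, so the
  codimension of \<open>Z\<close> is at most \<open>card S\<close>; and \<open>Z\<close> itself
  gives a flat avoiding the elements.\<close>

lemma critical_number_le:
  assumes Z: "bv.subspace Z" "Z \<subseteq> F2 (mdim M)" "Z \<inter> elts M = {}"
    and S: "finite S" "F2 (mdim M) \<subseteq> bv.span (Z \<union> S)"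
  shows "critical_number M \<le> card S"
proof -
  define n where "n = mdim M"
  obtain B where B: "B \<subseteq> Z" "bv.independent B" "Z \<subseteq> bv.span B" "card B = bv.dim Z"
    using bv.basis_exists by blast
  have finB: "finite B" using B(1) Z(2) finite_F2 finite_subset by (metis subset_trans)
  have "Z \<union> S \<subseteq> bv.span (B \<union> S)"
    using B(3) bv.span_mono[of B "B \<union> S"] bv.span_superset[of "B \<union> S"] by blast
  then have "F2 n \<subseteq> bv.span (B \<union> S)"
    using S(2) bv.span_minimal[of "Z \<union> S" "bv.span (B \<union> S)"] by (auto simp: n_def)
  then have "n \<le> card (B \<union> S)"
    using bv.dim_le_card[of "F2 n" "B \<union> S"] finB S(1) by (simp add: dim_F2)
  then have le: "n \<le> bv.dim Z + card S"
    using card_Un_le[of B S] B(4) by linarith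
  have "bv.span (unit2 ` {..<n}) = F2 n" using F2_basis by blast
  then have "card B \<le> card (unit2 ` {..<n})"
    using bv.independent_span_bound[of "unit2 ` {..<n}" B] B(1,2) Z(2) n_def by auto
  also have "\<dots> \<le> n" using card_image_le[of "{..<n}" unit2] by simp
  \<comment> \<open>The bound \<open>card B \<le> n\<close> makes this subtraction of natural
    numbers exact.\<close>
  finally have "bv.dim Z + (n - bv.dim Z) = n" using B(4) by simp
  moreover have "is_flat M (bv.dim Z) (Z - {0})"
    using Z unfolding is_flat_def by blast
  moreover have "Z - {0} \<subseteq> geometry M - elts M" using Z by (auto simp: geometry_def)
  ultimately have "critical_number M \<le> n - bv.dim Z"
    unfolding critical_number_def n_def by (intro Least_le) blast
  then show ?thesis using le by linarith
qed

context claw_fano_free begin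

text \<open>A maximal choice exists because \<open>F2 n\<close> is finite. If the coset of
  \<open>v\<close> missed \<open>E\<close>, adjoining \<open>v\<close> would enlarge
  \<open>Z\<close>.\<close>

lemma maximal_free_subspace:
  obtains Z where "bv.subspace Z" "Z \<subseteq> F2 n" "Z \<inter> E = {}"
    "\<And>v. v \<in> F2 n \<Longrightarrow> v \<notin> Z \<Longrightarrow> \<exists>z\<in>Z. v + z \<in> E"
proof -
  define A where "A = {Z. bv.subspace Z \<and> Z \<subseteq> F2 n \<and> Z \<inter> E = {}}"
  have mem: "Y \<in> A \<longleftrightarrow> bv.subspace Y \<and> Y \<subseteq> F2 n \<and> Y \<inter> E = {}" for Y
    by (simp only: A_def mem_Collect_eq)
  have "A \<subseteq> Pow (F2 n)" using mem by blast
  then have fin: "finite A" using finite_F2 finite_subset by blast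
  have "0 \<in> F2 n" by (simp add: F2_def)
  then have "{0} \<in> A" unfolding mem using zero_notin bv.subspace_single_0 by blast
  then have ne: "A \<noteq> {}" by blast
  obtain Z where "Z \<in> A" and max: "\<forall>Y\<in>A. Z \<subseteq> Y \<longrightarrow> Z = Y"
    using finite_has_maximal[OF fin ne] ..
  then have Z: "bv.subspace Z" "Z \<subseteq> F2 n" "Z \<inter> E = {}" using mem by blast+
  have "\<exists>z\<in>Z. v + z \<in> E" if v: "v \<in> F2 n" "v \<notin> Z" for v
  proof (rule ccontr)
    assume n: "\<not> (\<exists>z\<in>Z. v + z \<in> E)"
    have "Z \<union> (+) v ` Z \<subseteq> F2 n"
      using Z(2) v(1) bv.subspace_add[OF subspace_F2] by blast
    moreover have "(Z \<union> (+) v ` Z) \<inter> E = {}" using Z(3) n by blast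
    ultimately have "Z \<union> (+) v ` Z \<in> A"
      unfolding mem using subspace_insert[OF Z(1)] by (intro conjI)
    from max[rule_format, OF this Un_upper1] have "Z = Z \<union> (+) v ` Z" .
    moreover have "v + 0 \<in> (+) v ` Z" by (rule imageI[OF bv.subspace_0[OF Z(1)]])
    ultimately have "v + 0 \<in> Z" by blast
    then show False using v(2) by simp
  qed
  then show ?thesis by (rule that[OF Z])
qed

text \<open>A vector outside \<open>Z\<close> is the sum of an element of \<open>E\<close> and one
  of \<open>Z\<close>, so it is enough to generate \<open>E\<close>.\<close>

lemma span_maximal_free_subspace:
  assumes "\<And>v. v \<in> F2 n \<Longrightarrow> v \<notin> Z \<Longrightarrow> \<exists>z\<in>Z. v + z \<in> E"
    and "E \<subseteq> bv.span (Z \<union> S)"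
  shows "F2 n \<subseteq> bv.span (Z \<union> S)"
proof
  fix v assume v: "v \<in> F2 n"
  show "v \<in> bv.span (Z \<union> S)"
  proof (cases "v \<in> Z")
    case False
    then obtain z where z: "z \<in> Z" "v + z \<in> E" using assms(1) v by blast
    then have "v + z \<in> bv.span (Z \<union> S)" "z \<in> bv.span (Z \<union> S)"
      using assms(2) by (auto intro: bv.span_base)
    then have "v + z + z \<in> bv.span (Z \<union> S)" by (rule bv.span_add)
    then show ?thesis by (simp add: add.assoc)
  qed (auto intro: bv.span_base)
qed

text \<open>Modulo \<open>Z\<close>, the part of \<open>U\<close> in the span of \<open>E\<close>
  has dimension at most 1: two independent cosets and their sum would have representatives in
  \<open>E \<inter> U\<close> with total in \<open>Z\<close>, hence outside \<open>E\<close>, and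
  these form a claw as \<open>E \<inter> U\<close> has no triangle. The vector \<open>u\<close>
  accounts for the rest.\<close>

lemma five_bound:
  assumes five: "five_point_plane c d u"
    and Z: "bv.subspace Z" "Z \<inter> E = {}"
    and max: "\<And>v. v \<in> bv.span E \<Longrightarrow> v \<notin> Z \<Longrightarrow> \<exists>z\<in>Z. v + z \<in> E"
  obtains y where "E \<subseteq> bv.span (Z \<union> {y, u})"
proof -
  obtain U where U: "bv.subspace U" "u \<in> E"
    "\<And>x. x \<in> bv.span E \<Longrightarrow> x \<in> U \<or> x + u \<in> U" "\<And>x. x + u \<in> U \<Longrightarrow> x \<in> E"
    using five_structure[OF five] by blast
  have no_triangle: False if "a \<in> U" "b \<in> U" "a \<in> E" "b \<in> E" "a + b \<in> E" for a b
  proof -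
    have "a + b \<in> U" using U(1) that bv.subspace_add by blast
    then have "a + u \<in> E" "b + u \<in> E" "a + b + u \<in> E"
      using U(4)[of "a + u"] U(4)[of "b + u"] U(4)[of "a + b + u"] that by (simp_all add: add.assoc)
    then show False using fano_free[of a b u] that U(2) by blast
  qed
  have lift: "\<exists>e\<in>E. e \<in> U \<and> y + e \<in> Z" if y: "y \<in> U" "y \<in> bv.span E" "y \<notin> Z" for y
  proof -
    obtain z where z: "z \<in> Z" "y + z \<in> E" using max y by blast
    have "y + (y + z) \<in> bv.span E" by (intro bv.span_add y(2) bv.span_base z(2))
    then have "z \<in> bv.span E" by simp
    moreover have "z \<notin> E" using Z(2) z(1) by blast
    \<comment> \<open>Otherwise \<open>z + u \<in> U\<close>, which would put \<open>z\<close> into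
      \<open>E\<close>.\<close>
    ultimately have "z \<in> U" using U(3)[of z] U(4)[of z] by blast
    then have "y + z \<in> U" by (intro bv.subspace_add U(1) y(1))
    moreover have "y + (y + z) \<in> Z" using z(1) by simp
    ultimately show ?thesis using z(2) by blast
  qed
  have two: "y1 + y2 \<in> Z"
    if y: "y1 \<in> U" "y1 \<in> bv.span E" "y1 \<notin> Z" "y2 \<in> U" "y2 \<in> bv.span E" "y2 \<notin> Z" for y1 y2
  proof (rule ccontr)
    assume n: "y1 + y2 \<notin> Z"
    have "y1 + y2 \<in> U" "y1 + y2 \<in> bv.span E" using y U(1) bv.subspace_add bv.span_add by blast+
    then obtain a b c where e: "a \<in> E" "a \<in> U" "y1 + a \<in> Z" "b \<in> E" "b \<in> U" "y2 + b \<in> Z"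
      "c \<in> E" "c \<in> U" "y1 + y2 + c \<in> Z"
      using lift[OF y(1-3)] lift[OF y(4-6)] lift[of "y1 + y2"] n by blast
    have Zadd: "p + q \<in> Z" if "p \<in> Z" "q \<in> Z" for p q using Z(1) that bv.subspace_add by blast
    have "(y1 + a) + (y2 + b) + (y1 + y2 + c) \<in> Z" using Zadd e by blast
    then have "a + b + c \<in> Z" by (simp add: char2)
    then have "a + b + c \<notin> E" using Z(2) by blast
    moreover have "a \<noteq> b"
    proof
      assume "a = b" then have "(y1 + a) + (y2 + b) = y1 + y2" by (simp add: char2)
      then show False using Zadd e n by metis
    qed
    moreover have "a \<noteq> c"
    proof
      assume "a = c" then have "(y1 + a) + (y1 + y2 + c) = y2" by (simp add: char2)
      then show False using Zadd e y by metis
    qed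
    moreover have "b \<noteq> c"
    proof
      assume "b = c" then have "(y2 + b) + (y1 + y2 + c) = y1" by (simp add: char2)
      then show False using Zadd e y by metis
    qed
    moreover have "a + b \<notin> E" "a + c \<notin> E" "b + c \<notin> E" using no_triangle e by blast+
    moreover from this have "a + b \<noteq> c" using e by blast
    ultimately show False using claw_free[of a b c] e by blast
  qed
  \<comment> \<open>Any such vector outside \<open>Z\<close> serves as \<open>y\<close>; if there is
    none, \<open>y\<close> is arbitrary.\<close>
  obtain y where y: "\<And>x. x \<in> U \<Longrightarrow> x \<in> bv.span E \<Longrightarrow> x \<in> Z \<or> y + x \<in> Z"
    using two by blast
  have x: "x \<in> bv.span (Z \<union> {y, u})" if "x \<in> U" "x \<in> bv.span E" for x
  proof -
    have "y \<in> bv.span (Z \<union> {y, u})" by (simp add: bv.span_base)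
    moreover have "x \<in> bv.span (Z \<union> {y, u}) \<or> y + x \<in> bv.span (Z \<union> {y, u})"
      using y[OF that] by (auto intro: bv.span_base)
    ultimately show ?thesis using bv.span_add[of y _ "y + x"] by auto
  qed
  have "e \<in> bv.span (Z \<union> {y, u})" if e: "e \<in> E" for e
  proof -
    have "u \<in> bv.span (Z \<union> {y, u})" by (simp add: bv.span_base)
    moreover have "e \<in> U \<or> e + u \<in> U" "e \<in> bv.span E" "e + u \<in> bv.span E"
      using U(2,3) e by (auto intro: bv.span_base bv.span_add)
    ultimately show ?thesis using x bv.span_add[of "e + u" _ u] by (auto simp: add.assoc)
  qed
  then show ?thesis using that by blast
qed

end

section \<open>Quadratic forms over the two-element field\<close>

definition polar :: "((nat \<Rightarrow> bit) \<Rightarrow> bit) \<Rightarrow> (nat \<Rightarrow> bit) \<Rightarrow> (nat \<Rightarrow> bit) \<Rightarrow> bit" where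
  "polar q x y = q x + q y + q (x + y)"

text \<open>Over two elements homogeneity amounts to \<open>q 0 = 0\<close>. Additivity in the
  second argument comes from the symmetry of \<open>polar\<close>.\<close>

definition quadratic_on :: "(nat \<Rightarrow> bit) set \<Rightarrow> ((nat \<Rightarrow> bit) \<Rightarrow> bit) \<Rightarrow> bool" where
  "quadratic_on V q \<longleftrightarrow> q 0 = 0 \<and>
     (\<forall>x\<in>V. \<forall>y\<in>V. \<forall>z\<in>V. polar q (x + z) y = polar q x y + polar q z y)"

text \<open>On a subspace this is linearity. The general codomain covers both embeddings and
  bit-valued functionals.\<close>

definition additive_on :: "(nat \<Rightarrow> bit) set \<Rightarrow> ((nat \<Rightarrow> bit) \<Rightarrow> 'a::plus) \<Rightarrow> bool" where
  "additive_on V h \<longleftrightarrow> (\<forall>x\<in>V. \<forall>y\<in>V. h (x + y) = h x + h y)"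

lemma polar_commute: "polar q x y = polar q y x"
  by (simp only: polar_def char2)

lemma polar_add_eq: "q (x + y) = q x + q y + polar q x y"
  by (simp only: polar_def char2)

text \<open>The seven-term sum is the deviation of \<open>polar q\<close> from additivity.\<close>

lemma quadratic_onI:
  assumes "q 0 = 0"
    and "\<And>x y z. \<lbrakk>x \<in> V; y \<in> V; z \<in> V\<rbrakk> \<Longrightarrow>
      q x + q y + q z + q (x + y) + q (x + z) + q (y + z) + q (x + y + z) = 0"
  shows "quadratic_on V q"
  unfolding quadratic_on_def
proof (intro conjI ballI)
  fix x y z assume xyz: "x \<in> V" "y \<in> V" "z \<in> V"
  have "polar q (x + z) y = polar q x y + polar q z y +
      (q x + q y + q z + q (x + y) + q (x + z) + q (y + z) + q (x + y + z))"
    by (simp only: polar_def char2)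
  then show "polar q (x + z) y = polar q x y + polar q z y"
    by (simp only: assms(2)[OF xyz] add_0_right)
qed (rule assms(1))

lemma mem_F2_Suc_iff: "x \<in> F2 j \<longleftrightarrow> x \<in> F2 (Suc j) \<and> x j = 0"
  unfolding F2_def mem_Collect_eq by (metis le_eq_less_or_eq Suc_le_eq)

lemma mem_F2_Suc_cases:
  assumes x: "x \<in> F2 (Suc j)"
  obtains "x j = 0" "x \<in> F2 j" | "x j = 1" "x + unit2 j \<in> F2 j"
proof (cases "x j = 0")
  case True
  then have "x \<in> F2 j" using x mem_F2_Suc_iff by blast
  then show ?thesis by (rule that(1)[OF True])
next
  case False
  then have 1: "x j = 1" by simp
  have "unit2 j \<in> F2 (Suc j)" by (simp add: F2_def unit2_def)
  then have "x + unit2 j \<in> F2 (Suc j)" using x subspace_F2 bv.subspace_add by blast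
  moreover have "(x + unit2 j) j = 0" using 1 by (simp add: unit2_def)
  ultimately have "x + unit2 j \<in> F2 j" using mem_F2_Suc_iff by blast
  then show ?thesis by (rule that(2)[OF 1])
qed

section \<open>Embedding one quadratic form into another\<close>

locale quadratic_embedding =
  fixes V Z :: "(nat \<Rightarrow> bit) set" and q p :: "(nat \<Rightarrow> bit) \<Rightarrow> bit" and k :: nat
  assumes V: "bv.subspace V" and Z: "bv.subspace Z" "Z \<subseteq> V"
    and q: "quadratic_on V q" and q_Z: "z \<in> Z \<Longrightarrow> q z = 0"
    and p: "quadratic_on (F2 k) p"
begin

abbreviation "b \<equiv> polar q"

lemma V_add: "x \<in> V \<Longrightarrow> y \<in> V \<Longrightarrow> x + y \<in> V"
  using V bv.subspace_add by blast

lemma Z_add: "x \<in> Z \<Longrightarrow> y \<in> Z \<Longrightarrow> x + y \<in> Z"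
  using Z bv.subspace_add by blast

lemma b_add_left: "\<lbrakk>x \<in> V; y \<in> V; z \<in> V\<rbrakk> \<Longrightarrow> b (x + y) z = b x z + b y z"
  using q by (simp add: quadratic_on_def)

lemma b_add_right: "\<lbrakk>x \<in> V; y \<in> V; z \<in> V\<rbrakk> \<Longrightarrow> b z (x + y) = b z x + b z y"
  using b_add_left[of x y z] by (metis polar_commute)

lemma b_Z: "x \<in> Z \<Longrightarrow> y \<in> Z \<Longrightarrow> b x y = 0"
  using q_Z Z_add by (simp add: polar_def)

lemma b_zero: "b 0 y = 0" "b y 0 = 0"
  using q by (simp_all add: quadratic_on_def polar_def)

text \<open>The embedding \<open>\<phi>\<close> is built one basis vector at a time. The space \<open>Y\<close> keeps room for
  corrections: its elements induce every functional on the image of \<open>\<phi>\<close>. It is also small, since its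
  orthogonal space and the at most \<open>j\<close> vectors of \<open>S\<close> generate \<open>V\<close>.\<close>

definition partial_embedding where
  "partial_embedding j \<phi> Y S \<longleftrightarrow>
     \<phi> ` F2 j \<subseteq> V \<and> additive_on (F2 j) \<phi> \<and> (\<forall>x\<in>F2 j. q (\<phi> x) = p x) \<and>
     bv.subspace Y \<and> Y \<subseteq> Z \<and>
     (\<forall>h. additive_on (F2 j) h \<longrightarrow> (\<exists>z\<in>Y. \<forall>x\<in>F2 j. b (\<phi> x) z = h x)) \<and>
     finite S \<and> card S \<le> j \<and> S \<subseteq> V \<and>
     (\<forall>v\<in>V. \<exists>s\<in>bv.span S. \<forall>z\<in>Y. b (v + s) z = 0)"

lemma partial_embedding_dual:
  "partial_embedding j \<phi> Y S \<Longrightarrow> additive_on (F2 j) h \<Longrightarrow> \<exists>z\<in>Y. \<forall>x\<in>F2 j. b (\<phi> x) z = h x"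
  unfolding partial_embedding_def by blast

lemma partial_embedding_cover:
  "partial_embedding j \<phi> Y S \<Longrightarrow> v \<in> V \<Longrightarrow> \<exists>s\<in>bv.span S. \<forall>z\<in>Y. b (v + s) z = 0"
  unfolding partial_embedding_def by blast

lemma F2_0: "F2 0 = {0}"
  by (auto simp: F2_def fun_eq_iff)

lemma partial_embedding_0: "partial_embedding 0 (\<lambda>_. 0) {0} {}"
proof -
  have "h 0 = (0::bit)" if "additive_on {0} h" for h
  proof -
    have "h (0 + 0) = h 0 + h 0" using that unfolding additive_on_def by blast
    then show ?thesis by (simp only: add_self_bit add_0_left)
  qed
  moreover have "p 0 = 0" "q 0 = 0" using p q by (simp_all add: quadratic_on_def)
  moreover have "0 \<in> V" using V bv.subspace_0 by blast
  moreover have "0 \<in> Z" using Z bv.subspace_0 by blast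
  ultimately show ?thesis
    unfolding partial_embedding_def F2_0 by (simp add: additive_on_def b_zero)
qed

text \<open>The vector \<open>w\<close> will be the image of \<open>unit2 j\<close>, and
  \<open>t\<close> is dual to it. If the corrected vector \<open>u\<close> has the wrong value,
  \<open>u + t\<close> has the right one, since \<open>q t = 0\<close> and \<open>b u t = 1\<close>;
  its pairings with \<open>Y\<close> and with the image of \<open>\<phi>\<close> are those of
  \<open>u\<close>.\<close>

lemma partial_embedding_extend_vector:
  assumes part: "partial_embedding j \<phi> Y S" and j: "j < k"
    and v: "v \<in> V" "\<And>y. y \<in> Y \<Longrightarrow> b v y = 0" and z: "z \<in> Z" "b v z = 1"
  obtains w t where "w \<in> V" "t \<in> Z" "\<And>x. x \<in> F2 j \<Longrightarrow> b (\<phi> x) w = polar p x (unit2 j)"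
    "\<And>x. x \<in> F2 j \<Longrightarrow> b (\<phi> x) t = 0" "\<And>y. y \<in> Y \<Longrightarrow> b w y = 0" "b w t = 1" "q w = p (unit2 j)"
proof -
  note part' = part[unfolded partial_embedding_def]
  have \<phi>V: "\<phi> x \<in> V" if "x \<in> F2 j" for x using part' that by blast
  have \<phi>_add: "\<phi> (x + y) = \<phi> x + \<phi> y" if "x \<in> F2 j" "y \<in> F2 j" for x y
    using part' that unfolding additive_on_def by blast
  have YZ: "Y \<subseteq> Z" and YV: "Y \<subseteq> V" using part' Z by blast+
  have dual: "\<exists>z\<in>Y. \<forall>x\<in>F2 j. b (\<phi> x) z = h x" if "additive_on (F2 j) h" for h
    using part' that by blast
  have F2k: "x \<in> F2 k" if "x \<in> F2 j" for x using that j by (simp add: F2_def)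
  have e: "unit2 j \<in> F2 k" using j by (auto simp: F2_def unit2_def)
  have zV: "z \<in> V" using z Z by blast
  have "additive_on (F2 j) (\<lambda>x. b (\<phi> x) z)"
    unfolding additive_on_def using \<phi>_add \<phi>V b_add_left zV by simp
  \<comment> \<open>Adding \<open>z0\<close> makes \<open>z\<close> orthogonal to the image of
    \<open>\<phi>\<close> and keeps its pairing with \<open>v\<close>, which is orthogonal to
    \<open>Y\<close>.\<close>
  then obtain z0 where z0: "z0 \<in> Y" "\<And>x. x \<in> F2 j \<Longrightarrow> b (\<phi> x) z0 = b (\<phi> x) z"
    using dual by blast
  have "additive_on (F2 j) (\<lambda>x. polar p x (unit2 j) + b (\<phi> x) v)"
    unfolding additive_on_def
  proof (intro ballI)
    fix x y assume xy: "x \<in> F2 j" "y \<in> F2 j"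
    have "polar p (x + y) (unit2 j) = polar p x (unit2 j) + polar p y (unit2 j)"
      using p F2k xy e unfolding quadratic_on_def by blast
    moreover have "b (\<phi> (x + y)) v = b (\<phi> x) v + b (\<phi> y) v"
      using \<phi>_add \<phi>V b_add_left v(1) xy by simp
    ultimately show "polar p (x + y) (unit2 j) + b (\<phi> (x + y)) v =
      polar p x (unit2 j) + b (\<phi> x) v + (polar p y (unit2 j) + b (\<phi> y) v)"
      by (simp only: char2)
  qed
  then obtain z1 where z1: "z1 \<in> Y"
      "\<And>x. x \<in> F2 j \<Longrightarrow> b (\<phi> x) z1 = polar p x (unit2 j) + b (\<phi> x) v"
    using dual by blast
  define t where "t = z + z0"
  have z0': "z0 \<in> Z" "z0 \<in> V" and z1': "z1 \<in> Z" "z1 \<in> V" using z0 z1 YZ YV by blast+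
  have t: "t \<in> Z" "t \<in> V" using z z0' Z_add Z by (auto simp: t_def)
  have \<phi>t: "b (\<phi> x) t = 0" if "x \<in> F2 j" for x
    using z0 that \<phi>V zV z0' by (simp only: t_def b_add_right add_self_bit)
  have vt: "b v t = 1" using v z0(1) z0' zV z(2) by (simp add: t_def b_add_right)
  define u where "u = v + z1"
  have u: "u \<in> V" using v z1' V_add by (simp add: u_def)
  have \<phi>u: "b (\<phi> x) u = polar p x (unit2 j)" if "x \<in> F2 j" for x
    using z1 that \<phi>V v(1) z1' by (simp only: u_def b_add_right char2)
  have uY: "b u y = 0" if "y \<in> Y" for y
    using that v z1' b_Z YZ YV by (simp add: u_def b_add_left subset_iff)
  have ut: "b u t = 1"
    using vt v z1' t b_Z by (simp add: u_def b_add_left)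
  show ?thesis
  proof (cases "q u = p (unit2 j)")
    case True
    then show ?thesis using that[of u t] u t \<phi>u \<phi>t uY ut by blast
  next
    case False
    have "q (u + t) = q u + 1" using polar_add_eq[of q u t] q_Z[OF t(1)] ut by simp
    then have qw: "q (u + t) = p (unit2 j)" using False by (cases "q u") auto
    have "b (\<phi> x) (u + t) = polar p x (unit2 j)" if "x \<in> F2 j" for x
      using \<phi>u \<phi>t that \<phi>V u t by (simp add: b_add_right)
    moreover have "b (u + t) y = 0" if "y \<in> Y" for y
      using uY b_Z[OF t(1)] YZ YV that u t by (simp add: b_add_left subset_iff)
    moreover have "b (u + t) t = 1" using ut b_Z[OF t(1) t(1)] u t by (simp add: b_add_left)
    ultimately show ?thesis using that[of "u + t" t] u t \<phi>t V_add qw by blast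
  qed
qed

text \<open>The map is extended by \<open>w\<close>, while \<open>t\<close> joins \<open>Y\<close>
  and \<open>w\<close> joins \<open>S\<close>. As \<open>t\<close> pairs to 1 with \<open>w\<close>
  and to 0 with the old image, it adjusts a functional at \<open>unit2 j\<close> alone; as
  \<open>w\<close> is orthogonal to \<open>Y\<close>, adding it corrects a pairing with
  \<open>t\<close> alone.\<close>

lemma partial_embedding_Suc:
  assumes part: "partial_embedding j \<phi> Y S" and j: "j < k"
    and v: "v \<in> V" "\<And>y. y \<in> Y \<Longrightarrow> b v y = 0" and z: "z \<in> Z" "b v z = 1"
  shows "\<exists>\<phi> Y S. partial_embedding (Suc j) \<phi> Y S"
proof -
  obtain w t where w: "w \<in> V" and t: "t \<in> Z"
    and \<phi>w: "\<And>x. x \<in> F2 j \<Longrightarrow> b (\<phi> x) w = polar p x (unit2 j)"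
    and \<phi>t: "\<And>x. x \<in> F2 j \<Longrightarrow> b (\<phi> x) t = 0"
    and wY: "\<And>y. y \<in> Y \<Longrightarrow> b w y = 0" and wt: "b w t = 1" and qw: "q w = p (unit2 j)"
    using partial_embedding_extend_vector[OF assms] by metis
  have \<phi>V: "\<phi> x \<in> V" if "x \<in> F2 j" for x using part that unfolding partial_embedding_def by blast
  have \<phi>_add: "\<phi> (x + y) = \<phi> x + \<phi> y" if "x \<in> F2 j" "y \<in> F2 j" for x y
    using part that unfolding partial_embedding_def additive_on_def by blast
  have q\<phi>: "q (\<phi> x) = p x" if "x \<in> F2 j" for x using part that unfolding partial_embedding_def by blast
  have Y: "bv.subspace Y" "Y \<subseteq> Z" "Y \<subseteq> V" using part Z unfolding partial_embedding_def by blast+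
  have S: "finite S" "card S \<le> j" "S \<subseteq> V" using part unfolding partial_embedding_def by blast+
  have tV: "t \<in> V" using t Z by blast
  define \<psi> where "\<psi> x = (if x j = 0 then \<phi> x else \<phi> (x + unit2 j) + w)" for x
  define Y' where "Y' = Y \<union> (+) t ` Y"
  have \<psi>V: "\<psi> x \<in> V" if "x \<in> F2 (Suc j)" for x
    using that by (rule mem_F2_Suc_cases) (use \<phi>V w V_add in \<open>auto simp: \<psi>_def\<close>)
  have "additive_on (F2 (Suc j)) \<psi>"
    unfolding additive_on_def
  proof (intro ballI)
    fix x y assume xy: "x \<in> F2 (Suc j)" "y \<in> F2 (Suc j)"
    let ?e = "unit2 j"
    from xy(1) show "\<psi> (x + y) = \<psi> x + \<psi> y"
    proof (cases rule: mem_F2_Suc_cases)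
      case 1
      note x = 1
      from xy(2) show ?thesis
      proof (cases rule: mem_F2_Suc_cases)
        case 1
        then show ?thesis using x \<phi>_add by (simp add: \<psi>_def)
      next
        case 2
        have "\<phi> (x + y + ?e) = \<phi> x + \<phi> (y + ?e)"
          using \<phi>_add[OF x(2) 2(2)] by (simp only: add.assoc)
        then show ?thesis using x 2 by (simp add: \<psi>_def add.assoc)
      qed
    next
      case 2
      note x = 2
      from xy(2) show ?thesis
      proof (cases rule: mem_F2_Suc_cases)
        case 1
        have "x + y + ?e = (x + ?e) + y" by (simp only: char2)
        then have "\<phi> (x + y + ?e) = \<phi> (x + ?e) + \<phi> y" using \<phi>_add[OF x(2) 1(2)] by (simp only:)
        then show ?thesis using x 1 by (simp add: \<psi>_def add_ac)
      next
        case 2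
        have "x + y = (x + ?e) + (y + ?e)" by (simp only: char2)
        then have "\<phi> (x + y) = \<phi> (x + ?e) + \<phi> (y + ?e)" using \<phi>_add[OF x(2) 2(2)] by (simp only:)
        moreover have "(x + y) j = 0" using x 2 by simp
        moreover have "\<psi> x = \<phi> (x + ?e) + w" "\<psi> y = \<phi> (y + ?e) + w"
          using x 2 by (simp_all add: \<psi>_def)
        ultimately show ?thesis by (simp only: \<psi>_def if_True refl char2)
      qed
    qed
  qed
  moreover have "q (\<psi> x) = p x" if "x \<in> F2 (Suc j)" for x
    using that
  proof (cases rule: mem_F2_Suc_cases)
    case 1
    then show ?thesis using q\<phi> by (simp add: \<psi>_def)
  next
    case 2
    have "q (\<psi> x) = p (x + unit2 j) + p (unit2 j) + polar p (x + unit2 j) (unit2 j)"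
      using 2 polar_add_eq[of q "\<phi> (x + unit2 j)" w] q\<phi> qw \<phi>w by (simp add: \<psi>_def)
    also have "\<dots> = p x" using polar_add_eq[of p "x + unit2 j" "unit2 j"] by (simp add: add.assoc)
    finally show ?thesis .
  qed
  moreover have "bv.subspace Y'" unfolding Y'_def by (rule subspace_insert[OF Y(1)])
  moreover have "Y' \<subseteq> Z" using Y(2) t Z_add by (auto simp: Y'_def)
  moreover have "\<exists>z\<in>Y'. \<forall>x\<in>F2 (Suc j). b (\<psi> x) z = h x" if h: "additive_on (F2 (Suc j)) h" for h
  proof -
    have sub: "x \<in> F2 (Suc j)" if "x \<in> F2 j" for x using that by (simp add: F2_def)
    then have "additive_on (F2 j) h" using h unfolding additive_on_def by blast
    from partial_embedding_dual[OF part this]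
    obtain z where z: "z \<in> Y" "\<And>x. x \<in> F2 j \<Longrightarrow> b (\<phi> x) z = h x" by blast
    have zV: "z \<in> V" using z Y by blast
    have e: "unit2 j \<in> F2 (Suc j)" by (simp add: F2_def unit2_def)
    define z' where "z' = (if h (unit2 j) = 0 then z else t + z)"
    have z'V: "z' \<in> V" using zV tV V_add by (simp add: z'_def)
    have \<phi>z': "b (\<phi> x) z' = h x" if "x \<in> F2 j" for x
      using z \<phi>t that zV tV \<phi>V by (simp add: z'_def b_add_right)
    have wz': "b w z' = h (unit2 j)"
      using wt wY[OF z(1)] zV tV w by (cases "h (unit2 j)") (simp_all add: z'_def b_add_right)
    have "b (\<psi> x) z' = h x" if "x \<in> F2 (Suc j)" for x
      using that
    proof (cases rule: mem_F2_Suc_cases)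
      case 1
      then show ?thesis using \<phi>z' by (simp add: \<psi>_def)
    next
      case 2
      have "h (x + unit2 j + unit2 j) = h (x + unit2 j) + h (unit2 j)"
        using h sub[OF 2(2)] e unfolding additive_on_def by blast
      then have "h x = h (x + unit2 j) + h (unit2 j)" by (simp only: add.assoc add_self add_0_right)
      then show ?thesis using 2 \<phi>z' wz' \<phi>V w z'V by (simp add: \<psi>_def b_add_left)
    qed
    moreover have "z' \<in> Y'" using z(1) by (simp add: z'_def Y'_def)
    ultimately show ?thesis by blast
  qed
  moreover have "\<exists>s\<in>bv.span (insert w S). \<forall>z\<in>Y'. b (v + s) z = 0" if v: "v \<in> V" for v
  proof -
    obtain s where s: "s \<in> bv.span S" "\<And>z. z \<in> Y \<Longrightarrow> b (v + s) z = 0"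
      using partial_embedding_cover[OF part v] by blast
    have sV: "v + s \<in> V" using bv.span_minimal[OF S(3) V] s(1) v V_add by blast
    have s': "s \<in> bv.span (insert w S)" "s + w \<in> bv.span (insert w S)"
      using s(1) bv.span_mono[of S "insert w S"] bv.span_base[of w "insert w S"]
      by (auto intro: bv.span_add)
    have all: "\<forall>z\<in>Y'. b x z = 0" if "x \<in> V" "\<And>z. z \<in> Y \<Longrightarrow> b x z = 0" "b x t = 0" for x
    proof
      fix z assume "z \<in> Y'"
      then consider "z \<in> Y" | z' where "z' \<in> Y" "z = t + z'" by (auto simp: Y'_def)
      then show "b x z = 0"
        using that b_add_right[OF tV _ that(1)] Y(3) by cases auto
    qed
    show ?thesis
    proof (cases "b (v + s) t = 0")
      case True
      then show ?thesis using all[OF sV s(2)] s' by blast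
    next
      case False
      have "b (v + s + w) z = 0" if "z \<in> Y" for z
        using that s(2) wY sV w Y(3) by (simp add: b_add_left subset_iff)
      moreover have "b (v + s + w) t = 0" using False wt sV w tV by (simp add: b_add_left)
      ultimately have "\<forall>z\<in>Y'. b (v + s + w) z = 0" using all V_add sV w by blast
      then show ?thesis using s'(2) by (metis add.assoc)
    qed
  qed
  moreover have "card (insert w S) \<le> Suc j" using S by (simp add: card_insert_if)
  ultimately have "partial_embedding (Suc j) \<psi> Y' (insert w S)"
    unfolding partial_embedding_def using \<psi>V S w by auto
  then show ?thesis by blast
qed

text \<open>If step \<open>j\<close> cannot be extended, vectors orthogonal to \<open>Y\<close> are
  orthogonal to all of \<open>Z\<close>, so \<open>perp\<close> applies to them. Every vector of
  \<open>V\<close> is of this kind up to the span of \<open>S\<close>, which has at most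
  \<open>j < k\<close> generators.\<close>

lemma partial_embedding_or_span:
  assumes perp: "\<And>v. v \<in> V \<Longrightarrow> (\<And>z. z \<in> Z \<Longrightarrow> b v z = 0) \<Longrightarrow> v \<in> bv.span (Z \<union> A)"
    and "j \<le> k"
  shows "(\<exists>\<phi> Y S. partial_embedding j \<phi> Y S) \<or>
    (\<exists>S. finite S \<and> card S < k \<and> V \<subseteq> bv.span (Z \<union> (A \<union> S)))"
  using \<open>j \<le> k\<close>
proof (induction j)
  case 0
  then show ?case using partial_embedding_0 by blast
next
  case (Suc j)
  show ?case
  proof (rule ccontr)
    assume n: "\<not> ?case"
    then obtain \<phi> Y S where part: "partial_embedding j \<phi> Y S" using Suc by auto
    then have S: "finite S" "card S \<le> j" "S \<subseteq> V" unfolding partial_embedding_def by blast+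
    have "v \<in> bv.span (Z \<union> (A \<union> S))" if v: "v \<in> V" for v
    proof -
      obtain s where s: "s \<in> bv.span S" "\<And>z. z \<in> Y \<Longrightarrow> b (v + s) z = 0"
        using partial_embedding_cover[OF part v] by blast
      have sV: "v + s \<in> V" using bv.span_minimal[OF S(3) V] s(1) v V_add by blast
      have "b (v + s) z = 0" if "z \<in> Z" for z
        using partial_embedding_Suc[OF part _ sV s(2) that] n Suc.prems by (cases "b (v + s) z") auto
      then have "v + s \<in> bv.span (Z \<union> A)" using perp sV by blast
      then have "v + s \<in> bv.span (Z \<union> (A \<union> S))"
        using bv.span_mono[of "Z \<union> A" "Z \<union> (A \<union> S)"] by blast
      moreover have "s \<in> bv.span (Z \<union> (A \<union> S))"
        using s(1) bv.span_mono[of S "Z \<union> (A \<union> S)"] by blast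
      ultimately have "v + s + s \<in> bv.span (Z \<union> (A \<union> S))" by (rule bv.span_add)
      then show ?thesis by (simp add: add.assoc)
    qed
    then have "V \<subseteq> bv.span (Z \<union> (A \<union> S))" by blast
    then show False using n S Suc.prems by auto
  qed
qed

text \<open>Some coordinate of \<open>x\<close> is nonzero, and pairing with an element of
  \<open>Y\<close> realizes this coordinate functional.\<close>

lemma partial_embedding_injective:
  assumes part: "partial_embedding j \<phi> Y S" and x: "x \<in> F2 j" "x \<noteq> 0"
  shows "\<phi> x \<noteq> 0"
proof
  assume 0: "\<phi> x = 0"
  obtain i where i: "x i \<noteq> 0" using x(2) by (auto simp: fun_eq_iff)
  have "additive_on (F2 j) (\<lambda>x. x i)" by (simp add: additive_on_def)
  from partial_embedding_dual[OF part this] x(1) obtain z where "b (\<phi> x) z = x i" by blast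
  then show False using i 0 by (simp add: b_zero)
qed

end

section \<open>Induced restrictions from additive maps\<close>

lemma contains_inducedI:
  assumes add: "additive_on (F2 (mdim N)) \<phi>" and into: "\<phi> ` F2 (mdim N) \<subseteq> F2 (mdim M)"
    and inj: "\<And>x. x \<in> F2 (mdim N) \<Longrightarrow> x \<noteq> 0 \<Longrightarrow> \<phi> x \<noteq> 0"
    and elts: "\<And>x. x \<in> F2 (mdim N) \<Longrightarrow> x \<noteq> 0 \<Longrightarrow> \<phi> x \<in> elts M \<longleftrightarrow> x \<in> elts N"
    and N: "simple_binary_matroid N"
  shows "contains_induced M N"
proof -
  let ?V = "F2 (mdim N)"
  have closed: "x + y \<in> ?V" if "x \<in> ?V" "y \<in> ?V" for x y
    using subspace_F2[of "mdim N"] that by (simp add: subspace_iff)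
  have \<phi>_add: "\<phi> (x + y) = \<phi> x + \<phi> y" if "x \<in> ?V" "y \<in> ?V" for x y
    using add that by (simp add: additive_on_def)
  have "0 \<in> ?V" by (simp add: F2_def)
  from \<phi>_add[OF this this] have \<phi>0: "\<phi> 0 = 0" by simp
  have "inj_on \<phi> ?V"
  proof (rule inj_onI)
    fix x y assume xy: "x \<in> ?V" "y \<in> ?V" "\<phi> x = \<phi> y"
    then have "\<phi> (x + y) = 0" using \<phi>_add by simp
    then have "x + y = 0" using inj closed xy(1,2) by blast
    then show "x = y" by (simp add: add_eq_zero_iff_eq)
  qed
  moreover have "\<phi> (scale2 c x) = scale2 c (\<phi> x)" for c x
    using bit_cases[of c] \<phi>0 by auto
  ultimately have "injective_linear (mdim N) (mdim M) \<phi>"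
    using into \<phi>_add unfolding injective_linear_def by blast
  moreover have "\<phi> ` elts N = elts M \<inter> \<phi> ` geometry N"
    using elts N unfolding simple_binary_matroid_def geometry_def by blast
  ultimately show ?thesis unfolding contains_induced_def by blast
qed

lemma unit2_mem_F2: "i < n \<Longrightarrow> unit2 i \<in> F2 n"
  by (auto simp: F2_def unit2_def)

lemma unit2_eq_iff: "unit2 i = unit2 j \<longleftrightarrow> i = j"
  unfolding unit2_def by (metis zero_neq_one)

lemma unit2_nonzero: "unit2 i \<noteq> 0"
  by (auto simp: unit2_def fun_eq_iff)

lemma F2_3_eq_iff:
  assumes "x \<in> F2 3" "y \<in> F2 3"
  shows "x = y \<longleftrightarrow> x 0 = y 0 \<and> x 1 = y 1 \<and> x 2 = y 2"
proof
  assume xy: "x 0 = y 0 \<and> x 1 = y 1 \<and> x 2 = y 2"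
  have "x i = y i" for i
  proof (cases "i < 3")
    case True
    then have "i = 0 \<or> i = 1 \<or> i = 2" by auto
    then show ?thesis using xy by auto
  next
    case False
    then show ?thesis using assms by (simp add: F2_def)
  qed
  then show "x = y" by blast
qed simp

text \<open>The embedding sends the unit vectors to \<open>a\<close>, \<open>b\<close>,
  \<open>c\<close>. The inequations make these independent, and the seven equivalences cover the
  nonzero vectors of \<open>F2 3\<close>.\<close>

lemma contains_induced_planeI:
  assumes abc: "a \<in> F2 (mdim M)" "b \<in> F2 (mdim M)" "c \<in> F2 (mdim M)"
    and N: "simple_binary_matroid N" "mdim N = 3"
    and nz: "a \<noteq> 0" "b \<noteq> 0" "c \<noteq> 0" "a \<noteq> b" "a \<noteq> c" "b \<noteq> c" "a + b \<noteq> c"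
    and elts: "a \<in> elts M \<longleftrightarrow> unit2 0 \<in> elts N" "b \<in> elts M \<longleftrightarrow> unit2 1 \<in> elts N"
      "c \<in> elts M \<longleftrightarrow> unit2 2 \<in> elts N"
      "a + b \<in> elts M \<longleftrightarrow> unit2 0 + unit2 1 \<in> elts N"
      "a + c \<in> elts M \<longleftrightarrow> unit2 0 + unit2 2 \<in> elts N"
      "b + c \<in> elts M \<longleftrightarrow> unit2 1 + unit2 2 \<in> elts N"
      "a + b + c \<in> elts M \<longleftrightarrow> unit2 0 + unit2 1 + unit2 2 \<in> elts N"
  shows "contains_induced M N"
proof -
  let ?comb = "\<lambda>(x :: nat \<Rightarrow> bit) a b c. scale2 (x 0) a + scale2 (x 1) b + scale2 (x 2) c"
  define \<phi> where "\<phi> x = ?comb x a b c" for x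
  have u: "unit2 0 \<in> F2 3" "unit2 1 \<in> F2 3" "unit2 2 \<in> F2 3" by (simp_all add: unit2_mem_F2)
  note sub = bv.subspace_add[OF subspace_F2] bv.subspace_scale[OF subspace_F2]
  have x_eq: "x = ?comb x (unit2 0) (unit2 1) (unit2 2)" if "x \<in> F2 3" for x
  proof -
    have "?comb x (unit2 0) (unit2 1) (unit2 2) \<in> F2 3" by (intro sub u)
    then show ?thesis using that by (simp add: F2_3_eq_iff scale2_def unit2_def)
  qed
  have key: "\<phi> x \<noteq> 0 \<and> (\<phi> x \<in> elts M \<longleftrightarrow> x \<in> elts N)" if x: "x \<in> F2 3" "x \<noteq> 0" for x
  proof -
    have ne: "\<not> (x 0 = 0 \<and> x 1 = 0 \<and> x 2 = 0)"
      using x F2_3_eq_iff[OF x(1), of 0] by (auto simp: F2_def)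
    have nz': "a + b \<noteq> 0" "a + c \<noteq> 0" "b + c \<noteq> 0" "a + b + c \<noteq> 0"
      using nz by (simp_all add: add_eq_zero_iff_eq)
    consider "x 0 = 0" "x 1 = 0" "x 2 = 1" | "x 0 = 0" "x 1 = 1" "x 2 = 0"
      | "x 0 = 0" "x 1 = 1" "x 2 = 1" | "x 0 = 1" "x 1 = 0" "x 2 = 0"
      | "x 0 = 1" "x 1 = 0" "x 2 = 1" | "x 0 = 1" "x 1 = 1" "x 2 = 0"
      | "x 0 = 1" "x 1 = 1" "x 2 = 1"
      using ne by (cases "x 0"; cases "x 1"; cases "x 2") blast+
    then have "\<phi> x \<noteq> 0 \<and>
        (\<phi> x \<in> elts M \<longleftrightarrow> ?comb x (unit2 0) (unit2 1) (unit2 2) \<in> elts N)"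
      by cases (simp_all only: \<phi>_def scale2_simps add_0_left add_0_right elts nz nz' simp_thms not_False_eq_True)
    then show ?thesis unfolding x_eq[OF x(1), symmetric] .
  qed
  have "additive_on (F2 3) \<phi>"
    unfolding additive_on_def \<phi>_def
    by (simp only: plus_fun_apply bv.scale_left_distrib add_ac) simp
  moreover have "\<phi> ` F2 3 \<subseteq> F2 (mdim M)"
    unfolding \<phi>_def image_subset_iff by (intro ballI sub abc)
  ultimately show ?thesis using contains_inducedI[of N \<phi> M] key N by simp
qed

section \<open>Parity on flats of dimension 3\<close>

lemma span_insert_eq: "bv.span (insert a S) = bv.span S \<union> (+) a ` bv.span S"
proof
  have "a + 0 \<in> (+) a ` bv.span S" using bv.span_zero by blast
  then have "insert a S \<subseteq> bv.span S \<union> (+) a ` bv.span S" by (auto intro: bv.span_base)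
  then show "bv.span (insert a S) \<subseteq> bv.span S \<union> (+) a ` bv.span S"
    by (intro bv.span_minimal subspace_insert bv.subspace_span)
  have "bv.span S \<subseteq> bv.span (insert a S)" by (intro bv.span_mono) blast
  moreover have "a \<in> bv.span (insert a S)" by (simp add: bv.span_base)
  ultimately show "bv.span S \<union> (+) a ` bv.span S \<subseteq> bv.span (insert a S)"
    using bv.span_add by blast
qed

lemma sum_span_insert:
  assumes "finite (bv.span S)" "a \<notin> bv.span S"
  shows "sum f (bv.span (insert a S)) = sum f (bv.span S) + (\<Sum>x\<in>bv.span S. f (a + x))"
proof -
  have "a + x \<notin> bv.span S" if "x \<in> bv.span S" for x
    using bv.span_add[OF _ that, of "a + x"] assms(2) by (auto simp: add.assoc)
  then have "bv.span S \<inter> (+) a ` bv.span S = {}" by blast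
  then have "sum f (bv.span (insert a S)) = sum f (bv.span S) + sum f ((+) a ` bv.span S)"
    unfolding span_insert_eq using assms(1) by (intro sum.union_disjoint) auto
  also have "sum f ((+) a ` bv.span S) = (\<Sum>x\<in>bv.span S. f (a + x))"
    by (subst sum.reindex) (auto simp: inj_on_def)
  finally show ?thesis .
qed

lemma sum_span_three:
  fixes f :: "(nat \<Rightarrow> bit) \<Rightarrow> 'a::comm_monoid_add"
  assumes "z \<noteq> 0" "y \<notin> {0, z}" "x \<notin> {0, z, y, y + z}"
  shows "sum f (bv.span {x, y, z}) =
    f 0 + f z + (f y + f (y + z)) + (f x + f (x + z) + (f (x + y) + f (x + (y + z))))"
proof -
  have sp: "bv.span {} = {0}" "bv.span {z} = {0, z}" "bv.span {y, z} = {0, z, y, y + z}"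
    by (auto simp: span_insert_eq)
  have fin: "finite (bv.span {})" "finite (bv.span {z})" "finite (bv.span {y, z})"
    by (simp_all only: sp finite.intros)
  have notin: "z \<notin> bv.span {}" "y \<notin> bv.span {z}" "x \<notin> bv.span {y, z}"
    unfolding sp using assms by auto
  have "sum f (bv.span {x, y, z}) = sum f (bv.span {y, z}) + (\<Sum>v\<in>bv.span {y, z}. f (x + v))"
    using fin(3) notin(3) by (rule sum_span_insert)
  moreover have "sum g (bv.span {y, z}) = g 0 + g z + (g y + g (y + z))"
    for g :: "(nat \<Rightarrow> bit) \<Rightarrow> 'a"
    by (simp only: sum_span_insert[OF fin(2) notin(2)] sum_span_insert[OF fin(1) notin(1)])
      (simp add: sp(1) add.assoc)
  ultimately show ?thesis by simp
qed

text \<open>For an independent triple the seven terms count, modulo 2, the elements in a flat of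
  dimension 3. For a dependent triple they cancel.\<close>

lemma class_E3_quadratic:
  assumes "N \<in> class_E3"
  shows "quadratic_on (F2 (mdim N)) (\<lambda>x. of_bool (x \<in> elts N))"
proof (rule quadratic_onI)
  let ?p = "\<lambda>x. of_bool (x \<in> elts N) :: bit"
  have simple: "elts N \<subseteq> F2 (mdim N) - {0}"
    and even: "\<And>d F. 3 \<le> d \<Longrightarrow> is_flat N d F \<Longrightarrow> even (card (elts N \<inter> F))"
    using assms by (auto simp: class_E3_def simple_binary_matroid_def geometry_def)
  show p0: "?p 0 = 0" using simple by auto
  fix x y z assume xyz: "x \<in> F2 (mdim N)" "y \<in> F2 (mdim N)" "z \<in> F2 (mdim N)"
  show "?p x + ?p y + ?p z + ?p (x + y) + ?p (x + z) + ?p (y + z) + ?p (x + y + z) = 0"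
  proof (cases "x = 0 \<or> y = 0 \<or> z = 0 \<or> x = y \<or> x = z \<or> y = z \<or> x = y + z")
    case True
    then show ?thesis
      by (elim disjE) (simp_all only: char2 p0)
  next
    case False
    have sp: "bv.span {} = {0}" "bv.span {z} = {0, z}" "bv.span {y, z} = {0, z, y, y + z}"
      by (auto simp: span_insert_eq)
    have notin: "z \<notin> bv.span {}" "y \<notin> bv.span {z}" "x \<notin> bv.span {y, z}"
      using False by (auto simp: sp)
    have ind: "bv.independent {x, y, z}"
      using notin False by (simp add: bv.independent_insert bv.independent_empty)
    have V: "bv.span {x, y, z} \<subseteq> F2 (mdim N)"
      using xyz by (intro bv.span_minimal subspace_F2) auto
    have "bv.dim (bv.span {x, y, z}) = 3"
      using bv.dim_eq_card[OF _ ind, of "bv.span {x, y, z}"] False by (simp add: bv.span_span)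
    then have "is_flat N 3 (bv.span {x, y, z} - {0})"
      unfolding is_flat_def using V bv.subspace_span by blast
    then have "even (card (elts N \<inter> (bv.span {x, y, z} - {0})))" using even by blast
    moreover have "elts N \<inter> (bv.span {x, y, z} - {0}) = bv.span {x, y, z} \<inter> {v. v \<in> elts N}"
      using simple by auto
    ultimately have ev: "even (card (bv.span {x, y, z} \<inter> {v. v \<in> elts N}))" by simp
    have fin: "finite (bv.span {x, y, z})" by (rule finite_subset[OF V finite_F2])
    have "sum ?p (bv.span {x, y, z}) = of_nat (card (bv.span {x, y, z} \<inter> {v. v \<in> elts N}))"
      using fin by simp
    also have "\<dots> = 0" using ev by (auto elim!: evenE)
    finally have "sum ?p (bv.span {x, y, z}) = 0" .
    moreover note sum_span_three[of z y x ?p]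
    ultimately have "?p 0 + ?p z + (?p y + ?p (y + z)) +
        (?p x + ?p (x + z) + (?p (x + y) + ?p (x + (y + z)))) = 0"
      using False by auto
    then show ?thesis by (simp only: p0 char2)
  qed
qed

section \<open>The critical number when all planes are even\<close>

context claw_fano_free begin

text \<open>Either all \<open>k\<close> steps of the embedding succeed, or fewer than
  \<open>k\<close> vectors and two generators of the orthogonal space generate \<open>E\<close>
  modulo \<open>Z\<close>.\<close>

lemma quadratic_bound:
  assumes nofive: "\<And>c d u. \<not> five_point_plane c d u"
    and Z: "bv.subspace Z" "Z \<inter> E = {}"
    and max: "\<And>v. v \<in> bv.span E \<Longrightarrow> v \<notin> Z \<Longrightarrow> \<exists>z\<in>Z. v + z \<in> E"
    and p: "quadratic_on (F2 k) p"
  obtains \<phi> where "\<phi> ` F2 k \<subseteq> bv.span E" "additive_on (F2 k) \<phi>"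
    "\<And>x. x \<in> F2 k \<Longrightarrow> x \<noteq> 0 \<Longrightarrow> \<phi> x \<noteq> 0" "\<And>x. x \<in> F2 k \<Longrightarrow> ind (\<phi> x) = p x"
  | S where "finite S" "card S \<le> k + 1" "E \<subseteq> bv.span (Z \<union> S)"
proof -
  let ?V = "bv.span E"
  let ?Z = "Z \<inter> ?V"
  interpret quadratic_embedding ?V ?Z ind p k
  proof
    show "bv.subspace ?Z" using Z(1) bv.subspace_inter bv.subspace_span by blast
    show "quadratic_on ?V ind" using even_planes[OF nofive] by (intro quadratic_onI) simp_all
    show "quadratic_on (F2 k) p" by (rule p)
    fix z assume "z \<in> ?Z"
    then have "z \<notin> E" using Z(2) by blast
    then show "ind z = 0" by simp
  qed (auto simp: bv.subspace_span)
  define W where "W = {v \<in> ?V. \<forall>z\<in>?Z. b v z = 0}"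
  have W_add: "x + y \<in> W" if "x \<in> W" "y \<in> W" for x y
    using that V_add b_add_left by (auto simp: W_def)
  \<comment> \<open>Some \<open>v + z\<close> lies in \<open>E\<close>; as \<open>z\<close> is
    singular and orthogonal to \<open>v\<close>, the form has the same value at
    \<open>v\<close>.\<close>
  have W_E: "v \<in> E" if v: "v \<in> W" "v \<notin> ?Z" for v
  proof -
    have "v \<in> ?V" "v \<notin> Z" using v by (auto simp: W_def)
    then obtain z where z: "z \<in> Z" "v + z \<in> E" using max by blast
    then have "v + (v + z) \<in> ?V" using \<open>v \<in> ?V\<close> bv.span_add bv.span_base by blast
    then have "z \<in> ?Z" using z by simp
    then have "b v z = 0" "ind z = 0" using v(1) q_Z by (auto simp: W_def)
    then have "ind v = 1" using polar_add_eq[of ind v z] z(2) by simp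
    then show ?thesis by (auto simp: ind_def split: if_splits)
  qed
  \<comment> \<open>Three vectors of \<open>W\<close> independent modulo \<open>?Z\<close> would
    span a Fano plane by \<open>W_E\<close>. Smaller dimensions are covered because
    \<open>y1\<close> and \<open>y2\<close> may be dependent.\<close>
  have "\<exists>y1 y2. \<forall>v\<in>W. v \<in> ?Z \<or> y1 + v \<in> ?Z \<or> y2 + v \<in> ?Z \<or> y1 + (y2 + v) \<in> ?Z"
  proof (rule ccontr)
    assume "\<not> ?thesis"
    then have n: "\<exists>v\<in>W. v \<notin> ?Z \<and> y1 + v \<notin> ?Z \<and> y2 + v \<notin> ?Z \<and> y1 + (y2 + v) \<notin> ?Z" for y1 y2
      by blast
    obtain y1 where y1: "y1 \<in> W" "y1 \<notin> ?Z" using n[of 0 0] by auto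
    obtain y2 where y2: "y2 \<in> W" "y2 \<notin> ?Z" "y1 + y2 \<notin> ?Z" using n[of y1 0] by auto
    obtain y3 where y3: "y3 \<in> W" "y3 \<notin> ?Z" "y1 + y3 \<notin> ?Z" "y2 + y3 \<notin> ?Z" "y1 + (y2 + y3) \<notin> ?Z"
      using n[of y1 y2] by blast
    have "y1 \<in> E" "y2 \<in> E" "y3 \<in> E" "y1 + y2 \<in> E" "y1 + y3 \<in> E" "y2 + y3 \<in> E" "y1 + (y2 + y3) \<in> E"
      using y1 y2 y3 W_E W_add by simp_all
    then show False using fano_free[of y1 y2 y3] by (simp add: add.assoc)
  qed
  then obtain y1 y2 where y: "\<And>v. v \<in> W \<Longrightarrow>
    v \<in> ?Z \<or> y1 + v \<in> ?Z \<or> y2 + v \<in> ?Z \<or> y1 + (y2 + v) \<in> ?Z" by blast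
  have perp: "v \<in> bv.span (?Z \<union> {y1, y2})" if "v \<in> ?V" "\<And>z. z \<in> ?Z \<Longrightarrow> b v z = 0" for v
  proof -
    let ?X = "bv.span (?Z \<union> {y1, y2})"
    have v: "v \<in> W" using that by (simp add: W_def)
    have X: "y1 \<in> ?X" "y2 \<in> ?X" "x \<in> ?Z \<Longrightarrow> x \<in> ?X" for x by (simp_all add: bv.span_base)
    have "y1 + (y1 + v) \<in> ?X" if "y1 + v \<in> ?X" using that X(1) bv.span_add by blast
    moreover have "y2 + (y2 + v) \<in> ?X" if "y2 + v \<in> ?X" using that X(2) bv.span_add by blast
    moreover have "y2 + (y1 + (y1 + (y2 + v))) \<in> ?X" if "y1 + (y2 + v) \<in> ?X"
      using that X(1,2) bv.span_add by blast
    ultimately show ?thesis using y[OF v] X(3) by auto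
  qed
  have "(\<exists>\<phi> Y S. partial_embedding k \<phi> Y S) \<or>
      (\<exists>S. finite S \<and> card S < k \<and> ?V \<subseteq> bv.span (?Z \<union> ({y1, y2} \<union> S)))"
    by (rule partial_embedding_or_span[OF perp order_refl])
  then show ?thesis
  proof (elim disjE exE conjE)
    fix \<phi> Y S assume part: "partial_embedding k \<phi> Y S"
    show ?thesis
      using that(1)[of \<phi>] part partial_embedding_injective[OF part] unfolding partial_embedding_def by blast
  next
    fix S assume S: "finite S" "card S < k" "?V \<subseteq> bv.span (?Z \<union> ({y1, y2} \<union> S))"
    have "bv.span (?Z \<union> ({y1, y2} \<union> S)) \<subseteq> bv.span (Z \<union> ({y1, y2} \<union> S))"
      by (intro bv.span_mono) blast
    then have "E \<subseteq> bv.span (Z \<union> ({y1, y2} \<union> S))" using S(3) bv.span_superset[of E] by blast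
    moreover have "card ({y1, y2} \<union> S) \<le> k + 1"
      using card_Un_le[of "{y1, y2}" S] S(2) by (simp add: card_insert_if split: if_splits)
    ultimately show ?thesis using that(2)[of "{y1, y2} \<union> S"] S(1) by blast
  qed
qed

end

section \<open>From excluded restrictions to the bound\<close>

lemma claw_fano_free_elts:
  assumes simple: "simple_binary_matroid M"
    and noI3: "\<not> contains_induced M I3" and noF7: "\<not> contains_induced M F7"
  shows "claw_fano_free (elts M)"
proof -
  let ?E = "elts M" and ?n = "mdim M"
  have E: "?E \<subseteq> F2 ?n" and E0: "0 \<notin> ?E"
    using simple by (auto simp: simple_binary_matroid_def geometry_def)
  have u: "unit2 0 \<in> F2 3" "unit2 1 \<in> F2 3" "unit2 2 \<in> F2 3" by (simp_all add: unit2_mem_F2)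
  have sub: "x + y \<in> F2 n" if "x \<in> F2 n" "y \<in> F2 n" for x y n
    using subspace_F2[of n] that bv.subspace_add by blast
  have I3: "simple_binary_matroid I3" "mdim I3 = 3" and F7: "simple_binary_matroid F7" "mdim F7 = 3"
    using u unit2_nonzero by (auto simp: simple_binary_matroid_def geometry_def I3_def F7_def)
  have units: "unit2 0 + unit2 1 \<noteq> unit2 2" "unit2 0 + unit2 2 \<noteq> unit2 1"
    "unit2 1 + unit2 2 \<noteq> unit2 0" "unit2 0 + unit2 1 + unit2 2 \<noteq> 0"
    using u sub[OF u(1) u(2)] sub[OF u(1) u(3)] sub[OF u(2) u(3)]
    by (simp_all add: F2_3_eq_iff add_eq_zero_iff_eq) (simp_all add: unit2_def)
  note units' = units unit2_eq_iff unit2_nonzero add_eq_zero_iff_eq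
  show ?thesis
  proof
    show "0 \<notin> ?E" by (rule E0)
    fix a b c assume abc: "a \<in> ?E" "b \<in> ?E" "c \<in> ?E"
    then have nz: "a \<in> F2 ?n" "b \<in> F2 ?n" "c \<in> F2 ?n" "a \<noteq> 0" "b \<noteq> 0" "c \<noteq> 0"
      using E E0 by auto
    have I: "unit2 0 + unit2 1 \<notin> elts I3" "unit2 0 + unit2 2 \<notin> elts I3" "unit2 1 + unit2 2 \<notin> elts I3"
      "unit2 0 + unit2 1 + unit2 2 \<notin> elts I3" "unit2 0 \<in> elts I3" "unit2 1 \<in> elts I3" "unit2 2 \<in> elts I3"
      using units by (simp_all add: I3_def units')
    show "a + b + c \<in> ?E"
      if "a \<noteq> b" "a \<noteq> c" "b \<noteq> c" "a + b \<noteq> c" "a + b \<notin> ?E" "a + c \<notin> ?E" "b + c \<notin> ?E"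
    proof (rule ccontr)
      assume "a + b + c \<notin> ?E"
      then have "contains_induced M I3"
        by (intro contains_induced_planeI[OF nz(1-3) I3 nz(4-6) that(1-4)])
          (simp_all only: abc that I)
      then show False using noI3 by blast
    qed
    have F: "unit2 0 + unit2 1 \<in> elts F7" "unit2 0 + unit2 2 \<in> elts F7" "unit2 1 + unit2 2 \<in> elts F7"
      "unit2 0 + unit2 1 + unit2 2 \<in> elts F7" "unit2 0 \<in> elts F7" "unit2 1 \<in> elts F7" "unit2 2 \<in> elts F7"
      using u sub units by (simp_all add: F7_def units')
    show "a + b + c \<notin> ?E" if pairs: "a + b \<in> ?E" "a + c \<in> ?E" "b + c \<in> ?E"
    proof
      assume abc': "a + b + c \<in> ?E"
      \<comment> \<open>An equality would make one of the sums 0, which is not in the set.\<close>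
      have ne: "a \<noteq> b" "a \<noteq> c" "b \<noteq> c" "a + b \<noteq> c" using E0 pairs abc' by auto
      have "contains_induced M F7"
        by (intro contains_induced_planeI[OF nz(1-3) F7 nz(4-6) ne]) (simp_all only: abc pairs F abc')
      then show False using noF7 by blast
    qed
  qed
qed

theorem theorem1p2:
  fixes M N :: matroid
  assumes "N \<in> class_E3"
    and "simple_binary_matroid M"
    and "\<not> contains_induced M I3"
    and "\<not> contains_induced M F7"
    and "\<not> contains_induced M N"
  shows "critical_number M \<le> mdim N + 4"
proof -
  let ?E = "elts M" and ?n = "mdim M"
  have E: "?E \<subseteq> F2 ?n"
    using assms(2) by (auto simp: simple_binary_matroid_def geometry_def)
  interpret claw_fano_free ?E by (rule claw_fano_free_elts[OF assms(2-4)])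
  obtain Z where Z: "bv.subspace Z" "Z \<subseteq> F2 ?n" "Z \<inter> ?E = {}"
    and max: "\<And>v. v \<in> F2 ?n \<Longrightarrow> v \<notin> Z \<Longrightarrow> \<exists>z\<in>Z. v + z \<in> ?E"
    by (rule maximal_free_subspace[of ?n]) blast
  have V: "bv.span ?E \<subseteq> F2 ?n" by (intro bv.span_minimal E subspace_F2)
  have max': "\<And>v. v \<in> bv.span ?E \<Longrightarrow> v \<notin> Z \<Longrightarrow> \<exists>z\<in>Z. v + z \<in> ?E" using max subsetD[OF V] by blast
  have bound: "critical_number M \<le> card S" if "finite S" "?E \<subseteq> bv.span (Z \<union> S)" for S
    by (intro critical_number_le[OF Z that(1)] span_maximal_free_subspace[OF max that(2)])
  show ?thesis
  proof (cases "\<exists>c d u. five_point_plane c d u")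
    case True
    then obtain c d u where five: "five_point_plane c d u" by blast
    obtain y where "?E \<subseteq> bv.span (Z \<union> {y, u})"
      by (rule five_bound[OF five Z(1,3) max'])
    then have "critical_number M \<le> card {y, u}" by (intro bound) simp_all
    also have "\<dots> \<le> 2" by (simp add: card_insert_if)
    finally show ?thesis by simp
  next
    case False
    then have nofive: "\<And>c d u. \<not> five_point_plane c d u" by blast
    show ?thesis
    proof (rule quadratic_bound[OF nofive Z(1,3) max' class_E3_quadratic[OF assms(1)]])
      fix \<phi> assume \<phi>: "\<phi> ` F2 (mdim N) \<subseteq> bv.span ?E" "additive_on (F2 (mdim N)) \<phi>"
        "\<And>x. x \<in> F2 (mdim N) \<Longrightarrow> x \<noteq> 0 \<Longrightarrow> \<phi> x \<noteq> 0"
        "\<And>x. x \<in> F2 (mdim N) \<Longrightarrow> ind (\<phi> x) = of_bool (x \<in> elts N)"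
      \<comment> \<open>The embedded form is the indicator of \<open>elts N\<close>, so this outcome
        contradicts the exclusion of \<open>N\<close>.\<close>
      have "contains_induced M N"
      proof (rule contains_inducedI[OF \<phi>(2) _ \<phi>(3)])
        show "\<phi> ` F2 (mdim N) \<subseteq> F2 ?n" using \<phi>(1) V by blast
        show "simple_binary_matroid N" using assms(1) by (simp add: class_E3_def)
        show "\<phi> x \<in> ?E \<longleftrightarrow> x \<in> elts N" if "x \<in> F2 (mdim N)" for x
          using \<phi>(4)[OF that] by (auto simp: ind_def of_bool_def split: if_splits)
      qed
      then show ?thesis using assms(5) by blast
    next
      fix S assume "finite S" "card S \<le> mdim N + 1" "?E \<subseteq> bv.span (Z \<union> S)"
      then show ?thesis using bound[of S] by simp
    qed
  qed
qed

end
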